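(* Let $(\mu_\circ,\eta_\circ,\delta_\circ,\epsilon_\circ)$ and $(\mu_\bullet,\eta_\bullet,\delta_\bullet,\epsilon_\bullet)$ form a GHZ/W-pair on an object $Q$ of a symmetric monoidal category $\mathbf V$ with no non-trivial invertible scalars (invertible scalar factors being disregarded, as in $\mathbf{FHilb}_p$), and assume $\{\eta_\bullet,\tau\circ\eta_\bullet\}$ is a plugging set for $Q$. Let $\times:Q\to Q$ satisfy $\times\circ\times=1_Q$ and $\times\circ\mu_\circ=\mu_\circ\circ(\times\otimes 1_Q)$, and assume $\{\eta_\circ,\times\circ\eta_\circ\}$ is a plugging set for $Q$. Then for every $\psi:I\to Q$, $$\mu_\bullet\circ(\psi\otimes\times\circ\psi)=\big(\epsilon_\circ\circ\mu_\bullet\circ(\psi\otimes\times\circ\psi)\big)\cdot\eta_\bullet,$$ i.e. $\times$ acts as an additive inverse with respect to the addition $\mu_\bullet$ with unit $\eta_\bullet$.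
   Context: Let $(\mathbf V,\otimes,I,\sigma)$ be a symmetric monoidal category; scalars are morphisms $I\to I$ and $s\cdot f$ denotes $s\otimes f$ with $I\otimes X\cong X$. A commutative Frobenius algebra (CFA) on $Q$ is a commutative monoid $(Q,\mu,\eta)$ and cocommutative comonoid $(Q,\delta,\epsilon)$ with $(1\otimes\mu)(\delta\otimes 1)=\delta\mu=(\mu\otimes1)(1\otimes\delta)$. It is special if $\mu\circ\delta=1_Q$, and anti-special if $c\cdot(\mu\circ\delta)=(\mu\circ\delta\circ\eta)\circ(\epsilon\circ\mu\circ\delta)$ where $c=\epsilon\circ\mu\circ\delta\circ\eta$. A GHZ-structure is a special CFA $(\mu_\circ,\eta_\circ,\delta_\circ,\epsilon_\circ)$, a W-structure an anti-special CFA $(\mu_\bullet,\eta_\bullet,\delta_\bullet,\epsilon_\bullet)$, both on $Q$. Define $\tau:=(\epsilon_\bullet\mu_\bullet\otimes 1_Q)\circ(1_Q\otimes\delta_\circ\eta_\circ):Q\to Q$. They form a GHZ/W-pair if: ($\alpha$) $\tau=(\epsilon_\circ\mu_\circ\otimes 1_Q)\circ(1_Q\otimes\delta_\bullet\eta_\bullet)$; ($\beta$) $\delta_\circ\circ\eta_\bullet=\eta_\bullet\otimes\eta_\bullet$; ($\gamma$) $\delta_\circ\circ\tau=(\tau\otimes\tau)\circ\delta_\circ$; ($\xi$) $(\epsilon_\bullet\mu_\bullet\delta_\bullet\eta_\bullet)\cdot(\tau\circ\eta_\bullet)=\mu_\bullet\circ\delta_\bullet\circ\eta_\bullet$. A set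 of points $\{\psi_i:I\to Q\}$ is a plugging set if for all objects $A$ and $f,g:Q\to A$, $f=g$ iff $f\circ\psi_i=g\circ\psi_i$ for all $i$. *)

theory Defs
  imports Main
begin

record ('o, 'm) category_data =
  Obj :: "'o set"
  Arr :: "'m set"
  Dom :: "'m \<Rightarrow> 'o"
  Cod :: "'m \<Rightarrow> 'o"
  Id :: "'o \<Rightarrow> 'm"
  Comp :: "'m \<Rightarrow> 'm \<Rightarrow> 'm" (infixr "\<cdot>\<index>" 60)

definition hom :: "('o, 'm, 'z) category_data_scheme \<Rightarrow> 'o \<Rightarrow> 'o \<Rightarrow> 'm set" where
  "hom C A B = {f \<in> Arr C. Dom C f = A \<and> Cod C f = B}"

locale category =
  fixes C :: "('o, 'm, 'z) category_data_scheme" (structure)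
  assumes Dom_Obj: "f \<in> Arr C \<Longrightarrow> Dom C f \<in> Obj C"
    and Cod_Obj: "f \<in> Arr C \<Longrightarrow> Cod C f \<in> Obj C"
    and Id_hom: "A \<in> Obj C \<Longrightarrow> Id C A \<in> hom C A A"
    and Comp_hom: "f \<in> hom C A B \<Longrightarrow> g \<in> hom C B D \<Longrightarrow> g \<cdot> f \<in> hom C A D"
    and Comp_Id_left: "f \<in> hom C A B \<Longrightarrow> Id C B \<cdot> f = f"
    and Comp_Id_right: "f \<in> hom C A B \<Longrightarrow> f \<cdot> Id C A = f"
    and Comp_assoc: "f \<in> hom C A B \<Longrightarrow> g \<in> hom C B D \<Longrightarrow> h \<in> hom C D E \<Longrightarrow>
      (h \<cdot> g) \<cdot> f = h \<cdot> (g \<cdot> f)"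

definition inverse_arrows :: "('o, 'm, 'z) category_data_scheme \<Rightarrow> 'm \<Rightarrow> 'm \<Rightarrow> bool" where
  "inverse_arrows C f g \<longleftrightarrow> f \<in> Arr C \<and> g \<in> hom C (Cod C f) (Dom C f) \<and>
     g \<cdot>\<^bsub>C\<^esub> f = Id C (Dom C f) \<and> f \<cdot>\<^bsub>C\<^esub> g = Id C (Cod C f)"

definition iso :: "('o, 'm, 'z) category_data_scheme \<Rightarrow> 'm \<Rightarrow> bool" where
  "iso C f \<longleftrightarrow> (\<exists>g. inverse_arrows C f g)"

definition Inv :: "('o, 'm, 'z) category_data_scheme \<Rightarrow> 'm \<Rightarrow> 'm" where
  "Inv C f = (THE g. inverse_arrows C f g)"

record ('o, 'm) smc_data = "('o, 'm) category_data" +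
  TObj :: "'o \<Rightarrow> 'o \<Rightarrow> 'o" (infixr "\<otimes>\<^sub>o\<index>" 70)
  TArr :: "'m \<Rightarrow> 'm \<Rightarrow> 'm" (infixr "\<otimes>\<index>" 70)
  UnitObj :: 'o ("\<I>\<index>")
  Assoc :: "'o \<Rightarrow> 'o \<Rightarrow> 'o \<Rightarrow> 'm"
  LUnit :: "'o \<Rightarrow> 'm"
  RUnit :: "'o \<Rightarrow> 'm"
  Sym :: "'o \<Rightarrow> 'o \<Rightarrow> 'm"

locale monoidal_category = category V
  for V :: "('o, 'm, 'z) smc_data_scheme" (structure) +
  assumes TObj_Obj: "A \<in> Obj V \<Longrightarrow> B \<in> Obj V \<Longrightarrow> A \<otimes>\<^sub>o B \<in> Obj V"
    and UnitObj_Obj: "\<I> \<in> Obj V"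
    and TArr_hom: "f \<in> hom V A A' \<Longrightarrow> g \<in> hom V B B' \<Longrightarrow>
      f \<otimes> g \<in> hom V (A \<otimes>\<^sub>o B) (A' \<otimes>\<^sub>o B')"
    and TArr_Id: "A \<in> Obj V \<Longrightarrow> B \<in> Obj V \<Longrightarrow> Id V A \<otimes> Id V B = Id V (A \<otimes>\<^sub>o B)"
    and TArr_Comp: "f \<in> hom V A A' \<Longrightarrow> f' \<in> hom V A' A'' \<Longrightarrow>
      g \<in> hom V B B' \<Longrightarrow> g' \<in> hom V B' B'' \<Longrightarrow>
      (f' \<cdot> f) \<otimes> (g' \<cdot> g) = (f' \<otimes> g') \<cdot> (f \<otimes> g)"
    and Assoc_hom: "A \<in> Obj V \<Longrightarrow> B \<in> Obj V \<Longrightarrow> D \<in> Obj V \<Longrightarrow>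
      Assoc V A B D \<in> hom V ((A \<otimes>\<^sub>o B) \<otimes>\<^sub>o D) (A \<otimes>\<^sub>o (B \<otimes>\<^sub>o D))"
    and Assoc_iso: "A \<in> Obj V \<Longrightarrow> B \<in> Obj V \<Longrightarrow> D \<in> Obj V \<Longrightarrow> iso V (Assoc V A B D)"
    and Assoc_natural: "f \<in> hom V A A' \<Longrightarrow> g \<in> hom V B B' \<Longrightarrow> h \<in> hom V D D' \<Longrightarrow>
      Assoc V A' B' D' \<cdot> ((f \<otimes> g) \<otimes> h) = (f \<otimes> (g \<otimes> h)) \<cdot> Assoc V A B D"
    and LUnit_hom: "A \<in> Obj V \<Longrightarrow> LUnit V A \<in> hom V (\<I> \<otimes>\<^sub>o A) A"
    and LUnit_iso: "A \<in> Obj V \<Longrightarrow> iso V (LUnit V A)"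
    and LUnit_natural: "f \<in> hom V A B \<Longrightarrow> LUnit V B \<cdot> (Id V \<I> \<otimes> f) = f \<cdot> LUnit V A"
    and RUnit_hom: "A \<in> Obj V \<Longrightarrow> RUnit V A \<in> hom V (A \<otimes>\<^sub>o \<I>) A"
    and RUnit_iso: "A \<in> Obj V \<Longrightarrow> iso V (RUnit V A)"
    and RUnit_natural: "f \<in> hom V A B \<Longrightarrow> RUnit V B \<cdot> (f \<otimes> Id V \<I>) = f \<cdot> RUnit V A"
    and pentagon: "A \<in> Obj V \<Longrightarrow> B \<in> Obj V \<Longrightarrow> D \<in> Obj V \<Longrightarrow> E \<in> Obj V \<Longrightarrow>
      Assoc V A B (D \<otimes>\<^sub>o E) \<cdot> Assoc V (A \<otimes>\<^sub>o B) D E =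
      (Id V A \<otimes> Assoc V B D E) \<cdot> Assoc V A (B \<otimes>\<^sub>o D) E \<cdot> (Assoc V A B D \<otimes> Id V E)"
    and triangle: "A \<in> Obj V \<Longrightarrow> B \<in> Obj V \<Longrightarrow>
      (Id V A \<otimes> LUnit V B) \<cdot> Assoc V A \<I> B = RUnit V A \<otimes> Id V B"

locale symmetric_monoidal_category = monoidal_category V
  for V :: "('o, 'm, 'z) smc_data_scheme" (structure) +
  assumes Sym_hom: "A \<in> Obj V \<Longrightarrow> B \<in> Obj V \<Longrightarrow> Sym V A B \<in> hom V (A \<otimes>\<^sub>o B) (B \<otimes>\<^sub>o A)"
    and Sym_natural: "f \<in> hom V A A' \<Longrightarrow> g \<in> hom V B B' \<Longrightarrow>
      Sym V A' B' \<cdot> (f \<otimes> g) = (g \<otimes> f) \<cdot> Sym V A B"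
    and Sym_Sym: "A \<in> Obj V \<Longrightarrow> B \<in> Obj V \<Longrightarrow> Sym V B A \<cdot> Sym V A B = Id V (A \<otimes>\<^sub>o B)"
    and hexagon: "A \<in> Obj V \<Longrightarrow> B \<in> Obj V \<Longrightarrow> D \<in> Obj V \<Longrightarrow>
      Assoc V B D A \<cdot> Sym V A (B \<otimes>\<^sub>o D) \<cdot> Assoc V A B D =
      (Id V B \<otimes> Sym V A D) \<cdot> Assoc V B A D \<cdot> (Sym V A B \<otimes> Id V D)"

definition scalar_mult :: "('o, 'm, 'z) smc_data_scheme \<Rightarrow> 'm \<Rightarrow> 'm \<Rightarrow> 'm"
    (infixr "\<star>\<index>" 65) where
  "s \<star>\<^bsub>V\<^esub> f = LUnit V (Cod V f) \<cdot>\<^bsub>V\<^esub> (s \<otimes>\<^bsub>V\<^esub> f) \<cdot>\<^bsub>V\<^esub> Inv V (LUnit V (Dom V f))"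

definition no_nontrivial_invertible_scalars :: "('o, 'm, 'z) smc_data_scheme \<Rightarrow> bool" where
  "no_nontrivial_invertible_scalars V \<longleftrightarrow>
     (\<forall>s \<in> hom V \<I>\<^bsub>V\<^esub> \<I>\<^bsub>V\<^esub>. iso V s \<longrightarrow> s = Id V \<I>\<^bsub>V\<^esub>)"

text \<open>The tensor product of two points, precomposed with \<open>\<I> \<cong> \<I> \<otimes>\<^sub>o \<I>\<close> so that it is again a point.\<close>

definition point_tensor :: "('o, 'm, 'z) smc_data_scheme \<Rightarrow> 'm \<Rightarrow> 'm \<Rightarrow> 'm"
    (infixr "\<otimes>\<^sub>p\<index>" 70) where
  "p \<otimes>\<^sub>p\<^bsub>V\<^esub> q = (p \<otimes>\<^bsub>V\<^esub> q) \<cdot>\<^bsub>V\<^esub> Inv V (LUnit V \<I>\<^bsub>V\<^esub>)"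

definition plugging_set :: "('o, 'm, 'z) smc_data_scheme \<Rightarrow> 'o \<Rightarrow> 'm set \<Rightarrow> bool" where
  "plugging_set V Q P \<longleftrightarrow> P \<subseteq> hom V \<I>\<^bsub>V\<^esub> Q \<and>
     (\<forall>A \<in> Obj V. \<forall>f \<in> hom V Q A. \<forall>g \<in> hom V Q A.
        f = g \<longleftrightarrow> (\<forall>p \<in> P. f \<cdot>\<^bsub>V\<^esub> p = g \<cdot>\<^bsub>V\<^esub> p))"

definition commutative_monoid ::
    "('o, 'm, 'z) smc_data_scheme \<Rightarrow> 'o \<Rightarrow> 'm \<Rightarrow> 'm \<Rightarrow> bool" where
  "commutative_monoid V Q \<mu> \<eta> \<longleftrightarrow>
     \<mu> \<in> hom V (Q \<otimes>\<^sub>o\<^bsub>V\<^esub> Q) Q \<and> \<eta> \<in> hom V \<I>\<^bsub>V\<^esub> Q \<and>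
     \<mu> \<cdot>\<^bsub>V\<^esub> (\<mu> \<otimes>\<^bsub>V\<^esub> Id V Q) = \<mu> \<cdot>\<^bsub>V\<^esub> (Id V Q \<otimes>\<^bsub>V\<^esub> \<mu>) \<cdot>\<^bsub>V\<^esub> Assoc V Q Q Q \<and>
     \<mu> \<cdot>\<^bsub>V\<^esub> (\<eta> \<otimes>\<^bsub>V\<^esub> Id V Q) = LUnit V Q \<and>
     \<mu> \<cdot>\<^bsub>V\<^esub> (Id V Q \<otimes>\<^bsub>V\<^esub> \<eta>) = RUnit V Q \<and>
     \<mu> \<cdot>\<^bsub>V\<^esub> Sym V Q Q = \<mu>"

definition cocommutative_comonoid ::
    "('o, 'm, 'z) smc_data_scheme \<Rightarrow> 'o \<Rightarrow> 'm \<Rightarrow> 'm \<Rightarrow> bool" where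
  "cocommutative_comonoid V Q \<delta> \<epsilon> \<longleftrightarrow>
     \<delta> \<in> hom V Q (Q \<otimes>\<^sub>o\<^bsub>V\<^esub> Q) \<and> \<epsilon> \<in> hom V Q \<I>\<^bsub>V\<^esub> \<and>
     Assoc V Q Q Q \<cdot>\<^bsub>V\<^esub> (\<delta> \<otimes>\<^bsub>V\<^esub> Id V Q) \<cdot>\<^bsub>V\<^esub> \<delta> = (Id V Q \<otimes>\<^bsub>V\<^esub> \<delta>) \<cdot>\<^bsub>V\<^esub> \<delta> \<and>
     LUnit V Q \<cdot>\<^bsub>V\<^esub> (\<epsilon> \<otimes>\<^bsub>V\<^esub> Id V Q) \<cdot>\<^bsub>V\<^esub> \<delta> = Id V Q \<and>
     RUnit V Q \<cdot>\<^bsub>V\<^esub> (Id V Q \<otimes>\<^bsub>V\<^esub> \<epsilon>) \<cdot>\<^bsub>V\<^esub> \<delta> = Id V Q \<and>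
     Sym V Q Q \<cdot>\<^bsub>V\<^esub> \<delta> = \<delta>"

definition CFA ::
    "('o, 'm, 'z) smc_data_scheme \<Rightarrow> 'o \<Rightarrow> 'm \<Rightarrow> 'm \<Rightarrow> 'm \<Rightarrow> 'm \<Rightarrow> bool" where
  "CFA V Q \<mu> \<eta> \<delta> \<epsilon> \<longleftrightarrow>
     commutative_monoid V Q \<mu> \<eta> \<and> cocommutative_comonoid V Q \<delta> \<epsilon> \<and>
     (Id V Q \<otimes>\<^bsub>V\<^esub> \<mu>) \<cdot>\<^bsub>V\<^esub> Assoc V Q Q Q \<cdot>\<^bsub>V\<^esub> (\<delta> \<otimes>\<^bsub>V\<^esub> Id V Q) = \<delta> \<cdot>\<^bsub>V\<^esub> \<mu> \<and>
     \<delta> \<cdot>\<^bsub>V\<^esub> \<mu> = (\<mu> \<otimes>\<^bsub>V\<^esub> Id V Q) \<cdot>\<^bsub>V\<^esub> Inv V (Assoc V Q Q Q) \<cdot>\<^bsub>V\<^esub> (Id V Q \<otimes>\<^bsub>V\<^esub> \<delta>)"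

definition GHZ_structure ::
    "('o, 'm, 'z) smc_data_scheme \<Rightarrow> 'o \<Rightarrow> 'm \<Rightarrow> 'm \<Rightarrow> 'm \<Rightarrow> 'm \<Rightarrow> bool" where
  "GHZ_structure V Q \<mu> \<eta> \<delta> \<epsilon> \<longleftrightarrow> CFA V Q \<mu> \<eta> \<delta> \<epsilon> \<and> \<mu> \<cdot>\<^bsub>V\<^esub> \<delta> = Id V Q"

definition W_structure ::
    "('o, 'm, 'z) smc_data_scheme \<Rightarrow> 'o \<Rightarrow> 'm \<Rightarrow> 'm \<Rightarrow> 'm \<Rightarrow> 'm \<Rightarrow> bool" where
  "W_structure V Q \<mu> \<eta> \<delta> \<epsilon> \<longleftrightarrow> CFA V Q \<mu> \<eta> \<delta> \<epsilon> \<and>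
     (\<epsilon> \<cdot>\<^bsub>V\<^esub> \<mu> \<cdot>\<^bsub>V\<^esub> \<delta> \<cdot>\<^bsub>V\<^esub> \<eta>) \<star>\<^bsub>V\<^esub> (\<mu> \<cdot>\<^bsub>V\<^esub> \<delta>) =
     (\<mu> \<cdot>\<^bsub>V\<^esub> \<delta> \<cdot>\<^bsub>V\<^esub> \<eta>) \<cdot>\<^bsub>V\<^esub> (\<epsilon> \<cdot>\<^bsub>V\<^esub> \<mu> \<cdot>\<^bsub>V\<^esub> \<delta>)"

text \<open>\<open>(\<epsilon> \<mu> \<otimes> 1) \<cdot> (1 \<otimes> \<delta> \<eta>)\<close> with the coherence isomorphisms
  \<open>Q \<cong> Q \<otimes>\<^sub>o \<I>\<close>, \<open>Q \<otimes>\<^sub>o (Q \<otimes>\<^sub>o Q) \<cong> (Q \<otimes>\<^sub>o Q) \<otimes>\<^sub>o Q\<close> and \<open>\<I> \<otimes>\<^sub>o Q \<cong> Q\<close> inserted.\<close>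

definition cap_cup :: "('o, 'm, 'z) smc_data_scheme \<Rightarrow> 'o \<Rightarrow> 'm \<Rightarrow> 'm \<Rightarrow> 'm \<Rightarrow> 'm \<Rightarrow> 'm" where
  "cap_cup V Q \<epsilon> \<mu> \<delta> \<eta> =
     LUnit V Q \<cdot>\<^bsub>V\<^esub> ((\<epsilon> \<cdot>\<^bsub>V\<^esub> \<mu>) \<otimes>\<^bsub>V\<^esub> Id V Q) \<cdot>\<^bsub>V\<^esub> Inv V (Assoc V Q Q Q)
       \<cdot>\<^bsub>V\<^esub> (Id V Q \<otimes>\<^bsub>V\<^esub> (\<delta> \<cdot>\<^bsub>V\<^esub> \<eta>)) \<cdot>\<^bsub>V\<^esub> Inv V (RUnit V Q)"

text \<open>The index \<open>w\<close> (white) marks the GHZ-structure, \<open>b\<close> (black) the W-structure.\<close>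

definition tau :: "('o, 'm, 'z) smc_data_scheme \<Rightarrow> 'o \<Rightarrow> 'm \<Rightarrow> 'm \<Rightarrow> 'm \<Rightarrow> 'm \<Rightarrow> 'm" where
  "tau V Q \<eta>w \<delta>w \<mu>b \<epsilon>b = cap_cup V Q \<epsilon>b \<mu>b \<delta>w \<eta>w"

definition GHZ_W_pair ::
    "('o, 'm, 'z) smc_data_scheme \<Rightarrow> 'o \<Rightarrow> 'm \<Rightarrow> 'm \<Rightarrow> 'm \<Rightarrow> 'm \<Rightarrow> 'm \<Rightarrow> 'm \<Rightarrow> 'm \<Rightarrow> 'm \<Rightarrow> bool"
  where
  "GHZ_W_pair V Q \<mu>w \<eta>w \<delta>w \<epsilon>w \<mu>b \<eta>b \<delta>b \<epsilon>b \<longleftrightarrow>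
     GHZ_structure V Q \<mu>w \<eta>w \<delta>w \<epsilon>w \<and> W_structure V Q \<mu>b \<eta>b \<delta>b \<epsilon>b \<and>
     (let \<tau> = tau V Q \<eta>w \<delta>w \<mu>b \<epsilon>b in
        \<tau> = cap_cup V Q \<epsilon>w \<mu>w \<delta>b \<eta>b \<and>
        \<delta>w \<cdot>\<^bsub>V\<^esub> \<eta>b = \<eta>b \<otimes>\<^sub>p\<^bsub>V\<^esub> \<eta>b \<and>
        \<delta>w \<cdot>\<^bsub>V\<^esub> \<tau> = (\<tau> \<otimes>\<^bsub>V\<^esub> \<tau>) \<cdot>\<^bsub>V\<^esub> \<delta>w \<and>
        (\<epsilon>b \<cdot>\<^bsub>V\<^esub> \<mu>b \<cdot>\<^bsub>V\<^esub> \<delta>b \<cdot>\<^bsub>V\<^esub> \<eta>b) \<star>\<^bsub>V\<^esub> (\<tau> \<cdot>\<^bsub>V\<^esub> \<eta>b) = \<mu>b \<cdot>\<^bsub>V\<^esub> \<delta>b \<cdot>\<^bsub>V\<^esub> \<eta>b)"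

end

theory Submission
  imports Defs
begin

text \<open>
  Write \<open>0 = \<eta>\<^sub>\<bullet>\<close>, \<open>1 = \<tau> \<eta>\<^sub>\<bullet>\<close>; scalars act on points by precomposition. Both points are copied by
  \<open>\<delta>\<^sub>\<circ>\<close>, so the Frobenius law gives \<open>\<mu>\<^sub>\<circ>(p, q) = p \<cdot> \<epsilon>\<^sub>\<circ> \<mu>\<^sub>\<circ>(p, q)\<close> for \<open>p \<in> {0, 1}\<close>, and \<open>\<times>\<close>, being
  white multiplication by \<open>\<times> \<eta>\<^sub>\<circ>\<close>, acts on them by scalars \<open>s\<close> and \<open>t\<close>, with \<open>s\<^sup>2\<close> and \<open>t\<^sup>2\<close> acting trivially.
  The two expressions for \<open>\<tau>\<close> exchange the white and black caps; hence for \<open>N = \<mu>\<^sub>\<bullet>(1, 1)\<close> the white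
  pairing of \<open>N\<close> with \<open>1\<close> is \<open>k = \<epsilon>\<^sub>\<circ> \<mu>\<^sub>\<circ>(0, 1)\<close>. As \<open>\<mu>\<^sub>\<circ>(0, 1)\<close> equals both \<open>0 \<cdot> k\<close> and \<open>1 \<cdot> k\<close>, we get
  \<open>k s = k t\<close>, and nondegeneracy of the white cap gives \<open>s \<cdot> \<times> N = N\<close>. Plugging in \<open>0\<close> and \<open>1\<close> then
  shows \<open>\<mu>\<^sub>\<bullet>(\<times> a, \<times> b) = s \<cdot> \<times> \<mu>\<^sub>\<bullet>(a, b)\<close>. So \<open>\<phi> = \<mu>\<^sub>\<bullet>(\<psi>, \<times> \<psi>)\<close> satisfies \<open>\<times> \<phi> = s \<cdot> \<phi>\<close>, whence \<open>\<phi>\<close> and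
  \<open>(\<epsilon>\<^sub>\<circ> \<phi>) \<cdot> 0\<close> have the same white pairings with \<open>\<eta>\<^sub>\<circ>\<close> and \<open>\<times> \<eta>\<^sub>\<circ>\<close> and therefore coincide.
\<close>

section \<open>Categories: typing rules, inverses and cancellation\<close>

context category
begin

lemma homD:
  assumes "f \<in> hom C A B"
  shows "f \<in> Arr C" "Dom C f = A" "Cod C f = B" "A \<in> Obj C" "B \<in> Obj C"
  using assms Dom_Obj Cod_Obj by (auto simp: hom_def)

lemma arr_hom: "f \<in> Arr C \<Longrightarrow> f \<in> hom C (Dom C f) (Cod C f)"
  by (simp add: hom_def)

lemma Dom_Cod_Obj [simp]:
  assumes "f \<in> Arr C"
  shows "Dom C f \<in> Obj C" "Cod C f \<in> Obj C"
  using assms Dom_Obj Cod_Obj by auto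

lemma Id_arr [simp]:
  assumes "A \<in> Obj C"
  shows "Id C A \<in> Arr C" "Dom C (Id C A) = A" "Cod C (Id C A) = A"
  using Id_hom[OF assms] by (auto simp: hom_def)

lemma Comp_arr [simp]:
  assumes "f \<in> Arr C" "g \<in> Arr C" "Cod C f = Dom C g"
  shows "g \<cdot> f \<in> Arr C" "Dom C (g \<cdot> f) = Dom C f" "Cod C (g \<cdot> f) = Cod C g"
  using Comp_hom[of f "Dom C f" "Dom C g" g "Cod C g"] assms by (auto simp: hom_def)

lemma Comp_Id [simp]:
  assumes "f \<in> Arr C"
  shows "B = Cod C f \<Longrightarrow> Id C B \<cdot> f = f" "A = Dom C f \<Longrightarrow> f \<cdot> Id C A = f"
  using Comp_Id_left[OF arr_hom[OF assms]] Comp_Id_right[OF arr_hom[OF assms]] by auto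

text \<open>As a rewrite rule this nests every composite to the right, which is why later proofs
  bracket a group explicitly when a law is to act on it.\<close>

lemma Comp_assoc_arr [simp]:
  assumes "f \<in> Arr C" "g \<in> Arr C" "h \<in> Arr C" "Cod C f = Dom C g" "Cod C g = Dom C h"
  shows "(h \<cdot> g) \<cdot> f = h \<cdot> g \<cdot> f"
  using Comp_assoc[of f "Dom C f" "Dom C g" g "Dom C h" h "Cod C h"] assms by (auto simp: hom_def)

lemma inverse_arrows_Inv:
  assumes "iso C f"
  shows "inverse_arrows C f (Inv C f)"
proof -
  obtain g where g: "inverse_arrows C f g"
    using assms by (auto simp: iso_def)
  have "h = g" if h: "inverse_arrows C f h" for h
  proof -
    have "h = h \<cdot> f \<cdot> g"
      using g h by (simp add: inverse_arrows_def hom_def)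
    also have "\<dots> = (h \<cdot> f) \<cdot> g"
      using g h by (intro Comp_assoc_arr[symmetric]) (auto simp: inverse_arrows_def hom_def)
    also have "\<dots> = g"
      using g h by (simp add: inverse_arrows_def hom_def)
    finally show ?thesis .
  qed
  then show ?thesis
    unfolding Inv_def using g by (metis theI)
qed

lemma Inv_arr:
  assumes "iso C f" "f \<in> hom C A B"
  shows "Inv C f \<in> Arr C" "Dom C (Inv C f) = B" "Cod C (Inv C f) = A"
    "Inv C f \<cdot> f = Id C A" "f \<cdot> Inv C f = Id C B"
  using inverse_arrows_Inv[OF assms(1)] assms(2) by (auto simp: inverse_arrows_def hom_def)

lemma iso_cancel_right:
  assumes "iso C f" "f \<in> hom C A B" "g \<in> hom C B D" "h \<in> hom C B D" "g \<cdot> f = h \<cdot> f"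
  shows "g = h"
proof -
  note i = Inv_arr[OF assms(1,2)]
  have "g = (g \<cdot> f) \<cdot> Inv C f"
    using assms(2,3) i by (simp add: hom_def)
  also have "\<dots> = (h \<cdot> f) \<cdot> Inv C f"
    using assms(5) by simp
  also have "\<dots> = h"
    using assms(2,4) i by (simp add: hom_def)
  finally show ?thesis .
qed

end

section \<open>Monoidal categories: interchange and unit coherence\<close>

context monoidal_category
begin

declare TObj_Obj [simp] UnitObj_Obj [simp] TArr_Id [simp]

lemma TArr_arr [simp]:
  assumes "f \<in> Arr V" "g \<in> Arr V"
  shows "f \<otimes> g \<in> Arr V" "Dom V (f \<otimes> g) = Dom V f \<otimes>\<^sub>o Dom V g"
    "Cod V (f \<otimes> g) = Cod V f \<otimes>\<^sub>o Cod V g"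
  using TArr_hom[OF assms[THEN arr_hom]] by (auto simp: hom_def)

lemma interchange [simp]:
  assumes "f \<in> Arr V" "f' \<in> Arr V" "g \<in> Arr V" "g' \<in> Arr V"
    "Cod V f = Dom V f'" "Cod V g = Dom V g'"
  shows "(f' \<otimes> g') \<cdot> (f \<otimes> g) = (f' \<cdot> f) \<otimes> (g' \<cdot> g)"
  using TArr_Comp[of f _ _ f' _ g _ _ g'] assms by (auto simp: hom_def)

text \<open>In a right-nested chain two adjacent tensors followed by further arrows never form a
  subterm of their own; this variant lets interchange act there.\<close>

lemma interchange_Comp [simp]:
  assumes "f \<in> Arr V" "f' \<in> Arr V" "g \<in> Arr V" "g' \<in> Arr V" "h \<in> Arr V"
    "Cod V f = Dom V f'" "Cod V g = Dom V g'" "Cod V h = Dom V f \<otimes>\<^sub>o Dom V g"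
  shows "(f' \<otimes> g') \<cdot> (f \<otimes> g) \<cdot> h = ((f' \<cdot> f) \<otimes> (g' \<cdot> g)) \<cdot> h"
proof -
  have "(f' \<otimes> g') \<cdot> (f \<otimes> g) \<cdot> h = ((f' \<otimes> g') \<cdot> (f \<otimes> g)) \<cdot> h"
    using assms by (simp del: interchange)
  then show ?thesis
    using assms by simp
qed

lemma structure_arr [simp]:
  assumes "A \<in> Obj V"
  shows "LUnit V A \<in> Arr V" "Dom V (LUnit V A) = \<I> \<otimes>\<^sub>o A" "Cod V (LUnit V A) = A"
    "RUnit V A \<in> Arr V" "Dom V (RUnit V A) = A \<otimes>\<^sub>o \<I>" "Cod V (RUnit V A) = A"
    "Inv V (LUnit V A) \<in> Arr V" "Dom V (Inv V (LUnit V A)) = A"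
    "Cod V (Inv V (LUnit V A)) = \<I> \<otimes>\<^sub>o A"
    "Inv V (RUnit V A) \<in> Arr V" "Dom V (Inv V (RUnit V A)) = A"
    "Cod V (Inv V (RUnit V A)) = A \<otimes>\<^sub>o \<I>"
    "LUnit V A \<cdot> Inv V (LUnit V A) = Id V A"
    "Inv V (LUnit V A) \<cdot> LUnit V A = Id V (\<I> \<otimes>\<^sub>o A)"
    "RUnit V A \<cdot> Inv V (RUnit V A) = Id V A"
    "Inv V (RUnit V A) \<cdot> RUnit V A = Id V (A \<otimes>\<^sub>o \<I>)"
  using LUnit_hom[OF assms] RUnit_hom[OF assms]
    Inv_arr[OF LUnit_iso[OF assms] LUnit_hom[OF assms]]
    Inv_arr[OF RUnit_iso[OF assms] RUnit_hom[OF assms]] by (auto simp: hom_def)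

lemma Assoc_arr [simp]:
  assumes "A \<in> Obj V" "B \<in> Obj V" "D \<in> Obj V"
  shows "Assoc V A B D \<in> Arr V" "Dom V (Assoc V A B D) = (A \<otimes>\<^sub>o B) \<otimes>\<^sub>o D"
    "Cod V (Assoc V A B D) = A \<otimes>\<^sub>o B \<otimes>\<^sub>o D"
    "Inv V (Assoc V A B D) \<in> Arr V" "Dom V (Inv V (Assoc V A B D)) = A \<otimes>\<^sub>o B \<otimes>\<^sub>o D"
    "Cod V (Inv V (Assoc V A B D)) = (A \<otimes>\<^sub>o B) \<otimes>\<^sub>o D"
    "Assoc V A B D \<cdot> Inv V (Assoc V A B D) = Id V (A \<otimes>\<^sub>o B \<otimes>\<^sub>o D)"
    "Inv V (Assoc V A B D) \<cdot> Assoc V A B D = Id V ((A \<otimes>\<^sub>o B) \<otimes>\<^sub>o D)"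
  using Assoc_hom[OF assms] Inv_arr[OF Assoc_iso[OF assms] Assoc_hom[OF assms]]
  by (auto simp: hom_def)

lemma LUnit_nat: "f \<in> Arr V \<Longrightarrow> LUnit V (Cod V f) \<cdot> (Id V \<I> \<otimes> f) = f \<cdot> LUnit V (Dom V f)"
  using LUnit_natural arr_hom by blast

lemma RUnit_nat: "f \<in> Arr V \<Longrightarrow> RUnit V (Cod V f) \<cdot> (f \<otimes> Id V \<I>) = f \<cdot> RUnit V (Dom V f)"
  using RUnit_natural arr_hom by blast

lemma Assoc_nat:
  "f \<in> Arr V \<Longrightarrow> g \<in> Arr V \<Longrightarrow> h \<in> Arr V \<Longrightarrow>
    Assoc V (Cod V f) (Cod V g) (Cod V h) \<cdot> ((f \<otimes> g) \<otimes> h) =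
    (f \<otimes> (g \<otimes> h)) \<cdot> Assoc V (Dom V f) (Dom V g) (Dom V h)"
  using Assoc_natural arr_hom by blast

text \<open>Naturality of the left unitor expresses \<open>f\<close> composed with a unitor through
  \<open>Id V \<I> \<otimes> f\<close>, and the unitor is invertible, so tensoring with the unit
  object is faithful.\<close>

lemma Id_unit_tensor_cancel:
  assumes "f \<in> hom V A B" "g \<in> hom V A B" "Id V \<I> \<otimes> f = Id V \<I> \<otimes> g"
  shows "f = g"
proof (rule iso_cancel_right[OF LUnit_iso LUnit_hom assms(1,2)])
  show "A \<in> Obj V" "A \<in> Obj V"
    using assms(1) by (auto simp: homD)
  show "f \<cdot> LUnit V A = g \<cdot> LUnit V A"
    using assms LUnit_natural by metis
qed

lemma tensor_Id_unit_cancel: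
  assumes "f \<in> hom V A B" "g \<in> hom V A B" "f \<otimes> Id V \<I> = g \<otimes> Id V \<I>"
  shows "f = g"
proof (rule iso_cancel_right[OF RUnit_iso RUnit_hom assms(1,2)])
  show "A \<in> Obj V" "A \<in> Obj V"
    using assms(1) by (auto simp: homD)
  show "f \<cdot> RUnit V A = g \<cdot> RUnit V A"
    using assms RUnit_natural by metis
qed

lemma iso_tensor_Id:
  assumes "iso V f" "f \<in> hom V A B" "D \<in> Obj V"
  shows "iso V (f \<otimes> Id V D)"
  unfolding iso_def
proof
  show "inverse_arrows V (f \<otimes> Id V D) (Inv V f \<otimes> Id V D)"
    using Inv_arr[OF assms(1,2)] homD[OF assms(2)] assms(3)
    by (simp add: inverse_arrows_def hom_def)
qed

text \<open>Kelly's derivation of the redundant coherence axioms from pentagon and triangle.\<close>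

lemma LUnit_TObj:
  assumes A: "A \<in> Obj V" and B: "B \<in> Obj V"
  shows "LUnit V (A \<otimes>\<^sub>o B) \<cdot> Assoc V \<I> A B = LUnit V A \<otimes> Id V B"
proof (rule Id_unit_tensor_cancel)
  let ?a = "Assoc V \<I> (\<I> \<otimes>\<^sub>o A) B" and ?b = "Assoc V \<I> \<I> A \<otimes> Id V B"
  note [simp] = A B
  \<comment> \<open>Tensoring with \<open>\<I>\<close> and precomposing with two associators
    exhibits one side of the pentagon for \<open>\<I>\<close>, \<open>\<I>\<close>,
    \<open>A\<close>, \<open>B\<close>. Triangle and naturality transform it, and the invertible
    associators cancel at the end.\<close>
  have "(Id V \<I> \<otimes> (LUnit V (A \<otimes>\<^sub>o B) \<cdot> Assoc V \<I> A B)) \<cdot> ?a \<cdot> ?b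
      = (Id V \<I> \<otimes> LUnit V (A \<otimes>\<^sub>o B)) \<cdot> (Id V \<I> \<otimes> Assoc V \<I> A B) \<cdot> ?a \<cdot> ?b"
    by simp
  also have "\<dots> = (Id V \<I> \<otimes> LUnit V (A \<otimes>\<^sub>o B)) \<cdot> Assoc V \<I> \<I> (A \<otimes>\<^sub>o B) \<cdot> Assoc V (\<I> \<otimes>\<^sub>o \<I>) A B"
    by (simp only: pentagon A B UnitObj_Obj)
  also have "\<dots> = ((Id V \<I> \<otimes> LUnit V (A \<otimes>\<^sub>o B)) \<cdot> Assoc V \<I> \<I> (A \<otimes>\<^sub>o B)) \<cdot> Assoc V (\<I> \<otimes>\<^sub>o \<I>) A B"
    by simp
  also have "\<dots> = (RUnit V \<I> \<otimes> Id V A \<otimes> Id V B) \<cdot> Assoc V (\<I> \<otimes>\<^sub>o \<I>) A B"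
    by (simp add: triangle)
  also have "\<dots> = Assoc V \<I> A B \<cdot> ((RUnit V \<I> \<otimes> Id V A) \<otimes> Id V B)"
    using Assoc_nat[of "RUnit V \<I>" "Id V A" "Id V B"] by simp
  also have "\<dots> = Assoc V \<I> A B \<cdot> (((Id V \<I> \<otimes> LUnit V A) \<cdot> Assoc V \<I> \<I> A) \<otimes> Id V B)"
    by (simp only: triangle A UnitObj_Obj)
  also have "\<dots> = Assoc V \<I> A B \<cdot> (((Id V \<I> \<otimes> LUnit V A) \<otimes> Id V B) \<cdot> ?b)"
    by simp
  also have "\<dots> = (Assoc V \<I> A B \<cdot> ((Id V \<I> \<otimes> LUnit V A) \<otimes> Id V B)) \<cdot> ?b"
    by (simp del: interchange)
  also have "\<dots> = ((Id V \<I> \<otimes> LUnit V A \<otimes> Id V B) \<cdot> ?a) \<cdot> ?b"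
    using Assoc_nat[of "Id V \<I>" "LUnit V A" "Id V B"] by simp
  finally have eq: "((Id V \<I> \<otimes> (LUnit V (A \<otimes>\<^sub>o B) \<cdot> Assoc V \<I> A B)) \<cdot> ?a) \<cdot> ?b =
      ((Id V \<I> \<otimes> LUnit V A \<otimes> Id V B) \<cdot> ?a) \<cdot> ?b"
    by simp
  have "(Id V \<I> \<otimes> (LUnit V (A \<otimes>\<^sub>o B) \<cdot> Assoc V \<I> A B)) \<cdot> ?a = (Id V \<I> \<otimes> LUnit V A \<otimes> Id V B) \<cdot> ?a"
    by (rule iso_cancel_right[OF iso_tensor_Id[OF Assoc_iso Assoc_hom] _ _ _ eq])
      (auto simp: hom_def)
  then show "Id V \<I> \<otimes> (LUnit V (A \<otimes>\<^sub>o B) \<cdot> Assoc V \<I> A B) = Id V \<I> \<otimes> LUnit V A \<otimes> Id V B"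
    by (rule iso_cancel_right[OF Assoc_iso Assoc_hom, rotated -1]) (auto simp: hom_def)
qed (use assms in \<open>auto simp: hom_def\<close>)

lemma LUnit_eq_RUnit: "LUnit V \<I> = RUnit V \<I>"
proof (rule tensor_Id_unit_cancel)
  \<comment> \<open>Naturality of the left unitor is applied to the unitor itself. Cancelling the
    outer factor gives \<open>LUnit_TObj\<close> and the triangle at \<open>\<I>\<close> the same
    left-hand side.\<close>
  have "LUnit V \<I> \<cdot> LUnit V (\<I> \<otimes>\<^sub>o \<I>) = LUnit V \<I> \<cdot> (Id V \<I> \<otimes> LUnit V \<I>)"
    using LUnit_nat[of "LUnit V \<I>"] by simp
  then have "(Inv V (LUnit V \<I>) \<cdot> LUnit V \<I>) \<cdot> LUnit V (\<I> \<otimes>\<^sub>o \<I>) =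
      (Inv V (LUnit V \<I>) \<cdot> LUnit V \<I>) \<cdot> (Id V \<I> \<otimes> LUnit V \<I>)"
    by (simp del: structure_arr(14))
  then have "LUnit V (\<I> \<otimes>\<^sub>o \<I>) = Id V \<I> \<otimes> LUnit V \<I>"
    by simp
  then show "LUnit V \<I> \<otimes> Id V \<I> = RUnit V \<I> \<otimes> Id V \<I>"
    using LUnit_TObj[of \<I> \<I>] triangle[of \<I> \<I>] by simp
qed (auto simp: hom_def)

lemma Inv_LUnit_nat:
  assumes "f \<in> hom V A B"
  shows "(Id V \<I> \<otimes> f) \<cdot> Inv V (LUnit V A) = Inv V (LUnit V B) \<cdot> f"
proof -
  note [simp] = homD[OF assms]
  have "(Id V \<I> \<otimes> f) \<cdot> Inv V (LUnit V A) =
      (Inv V (LUnit V B) \<cdot> LUnit V B) \<cdot> (Id V \<I> \<otimes> f) \<cdot> Inv V (LUnit V A)"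
    by simp
  also have "\<dots> = Inv V (LUnit V B) \<cdot> (LUnit V B \<cdot> (Id V \<I> \<otimes> f)) \<cdot> Inv V (LUnit V A)"
    by (simp del: structure_arr(14))
  also have "\<dots> = Inv V (LUnit V B) \<cdot> (f \<cdot> LUnit V A) \<cdot> Inv V (LUnit V A)"
    using LUnit_natural[OF assms] by simp
  also have "\<dots> = Inv V (LUnit V B) \<cdot> f"
    by simp
  finally show ?thesis .
qed

lemma Inv_RUnit_nat:
  assumes "f \<in> hom V A B"
  shows "(f \<otimes> Id V \<I>) \<cdot> Inv V (RUnit V A) = Inv V (RUnit V B) \<cdot> f"
proof -
  note [simp] = homD[OF assms]
  have "(f \<otimes> Id V \<I>) \<cdot> Inv V (RUnit V A) =
      (Inv V (RUnit V B) \<cdot> RUnit V B) \<cdot> (f \<otimes> Id V \<I>) \<cdot> Inv V (RUnit V A)"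
    by simp
  also have "\<dots> = Inv V (RUnit V B) \<cdot> (RUnit V B \<cdot> (f \<otimes> Id V \<I>)) \<cdot> Inv V (RUnit V A)"
    by (simp del: structure_arr(16))
  also have "\<dots> = Inv V (RUnit V B) \<cdot> (f \<cdot> RUnit V A) \<cdot> Inv V (RUnit V A)"
    using RUnit_natural[OF assms] by simp
  also have "\<dots> = Inv V (RUnit V B) \<cdot> f"
    by simp
  finally show ?thesis .
qed

section \<open>Points, scalars and plugging\<close>

lemma point_tensor_arr [simp]:
  assumes "a \<in> Arr V" "b \<in> Arr V" "Dom V a = \<I>" "Dom V b = \<I>"
  shows "a \<otimes>\<^sub>p b \<in> Arr V" "Dom V (a \<otimes>\<^sub>p b) = \<I>"
    "Cod V (a \<otimes>\<^sub>p b) = Cod V a \<otimes>\<^sub>o Cod V b"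
  using assms by (auto simp: point_tensor_def)

lemma tensor_point_tensor [simp]:
  assumes "a \<in> Arr V" "b \<in> Arr V" "Dom V a = \<I>" "Dom V b = \<I>"
    "f \<in> Arr V" "g \<in> Arr V" "Dom V f = Cod V a" "Dom V g = Cod V b"
  shows "(f \<otimes> g) \<cdot> (a \<otimes>\<^sub>p b) = (f \<cdot> a) \<otimes>\<^sub>p (g \<cdot> b)"
  using assms by (simp add: point_tensor_def)

text \<open>A scalar in the left factor slides out through the right unitor, whereas
  \<open>point_tensor\<close> is built with the left one; \<open>LUnit_eq_RUnit\<close> reconciles
  them.\<close>

lemma point_tensor_scalar_left:
  assumes "a \<in> hom V \<I> A" "b \<in> hom V \<I> B" "s \<in> hom V \<I> \<I>"
  shows "(a \<cdot> s) \<otimes>\<^sub>p b = (a \<otimes>\<^sub>p b) \<cdot> s"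
proof -
  note [simp] = homD[OF assms(1)] homD[OF assms(2)] homD[OF assms(3)]
  have "(a \<cdot> s) \<otimes>\<^sub>p b = (a \<otimes> b) \<cdot> (s \<otimes> Id V \<I>) \<cdot> Inv V (LUnit V \<I>)"
    by (simp add: point_tensor_def)
  also have "\<dots> = (a \<otimes>\<^sub>p b) \<cdot> s"
    using Inv_RUnit_nat[OF assms(3)] by (simp add: point_tensor_def LUnit_eq_RUnit del: interchange_Comp)
  finally show ?thesis .
qed

lemma point_tensor_scalar_right:
  assumes "a \<in> hom V \<I> A" "b \<in> hom V \<I> B" "s \<in> hom V \<I> \<I>"
  shows "a \<otimes>\<^sub>p (b \<cdot> s) = (a \<otimes>\<^sub>p b) \<cdot> s"
proof -
  note [simp] = homD[OF assms(1)] homD[OF assms(2)] homD[OF assms(3)]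
  have "a \<otimes>\<^sub>p (b \<cdot> s) = (a \<otimes> b) \<cdot> (Id V \<I> \<otimes> s) \<cdot> Inv V (LUnit V \<I>)"
    by (simp add: point_tensor_def)
  also have "\<dots> = (a \<otimes>\<^sub>p b) \<cdot> s"
    using Inv_LUnit_nat[OF assms(3)] by (simp add: point_tensor_def del: interchange_Comp)
  finally show ?thesis .
qed

lemma LUnit_point_tensor:
  assumes "s \<in> hom V \<I> \<I>" "p \<in> hom V \<I> A"
  shows "LUnit V A \<cdot> (s \<otimes>\<^sub>p p) = p \<cdot> s"
proof -
  note [simp] = homD[OF assms(1)] homD[OF assms(2)]
  have "LUnit V A \<cdot> (s \<otimes>\<^sub>p p) = (LUnit V A \<cdot> (Id V \<I> \<otimes> p)) \<cdot> (s \<otimes> Id V \<I>) \<cdot> Inv V (LUnit V \<I>)"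
    by (simp add: point_tensor_def)
  also have "\<dots> = (p \<cdot> LUnit V \<I>) \<cdot> Inv V (LUnit V \<I>) \<cdot> s"
    using LUnit_natural[OF assms(2)] Inv_RUnit_nat[OF assms(1)] by (simp add: LUnit_eq_RUnit)
  also have "\<dots> = p \<cdot> (LUnit V \<I> \<cdot> Inv V (LUnit V \<I>)) \<cdot> s"
    by (simp del: structure_arr(13))
  finally show ?thesis
    by simp
qed

lemma RUnit_point_tensor:
  assumes "s \<in> hom V \<I> \<I>" "p \<in> hom V \<I> A"
  shows "RUnit V A \<cdot> (p \<otimes>\<^sub>p s) = p \<cdot> s"
proof -
  note [simp] = homD[OF assms(1)] homD[OF assms(2)]
  have "RUnit V A \<cdot> (p \<otimes>\<^sub>p s) = (RUnit V A \<cdot> (p \<otimes> Id V \<I>)) \<cdot> (Id V \<I> \<otimes> s) \<cdot> Inv V (LUnit V \<I>)"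
    by (simp add: point_tensor_def)
  also have "\<dots> = (p \<cdot> RUnit V \<I>) \<cdot> Inv V (LUnit V \<I>) \<cdot> s"
    using RUnit_natural[OF assms(2)] Inv_LUnit_nat[OF assms(1)] by simp
  also have "\<dots> = p \<cdot> (LUnit V \<I> \<cdot> Inv V (LUnit V \<I>)) \<cdot> s"
    by (simp add: LUnit_eq_RUnit del: structure_arr(13,15))
  finally show ?thesis
    by simp
qed

text \<open>This reduces the action of scalars on points to precomposition, the form in which
  scalars are handled from here on.\<close>

lemma scalar_mult_point:
  assumes "s \<in> hom V \<I> \<I>" "p \<in> hom V \<I> A"
  shows "s \<star> p = p \<cdot> s"
  using LUnit_point_tensor[OF assms] assms by (simp add: scalar_mult_def point_tensor_def hom_def)

text \<open>The Eckmann-Hilton argument: the left unitor sends \<open>s \<otimes>\<^sub>p t\<close>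
  to \<open>t \<cdot> s\<close>, the right unitor sends it to \<open>s \<cdot> t\<close>, and the
  two unitors agree at \<open>\<I>\<close>.\<close>

lemma scalar_commute:
  assumes "s \<in> hom V \<I> \<I>" "t \<in> hom V \<I> \<I>"
  shows "s \<cdot> t = t \<cdot> s"
  using LUnit_point_tensor[OF assms] RUnit_point_tensor[OF assms(2,1)] by (simp add: LUnit_eq_RUnit)

text \<open>Partial application of a binary map to a point. The result is an arrow out of the object
  itself, so that a plugging set can be used on one argument at a time.\<close>

definition insert_left :: "'m \<Rightarrow> 'm \<Rightarrow> 'm" where
  "insert_left m a = m \<cdot> (a \<otimes> Id V (Cod V a)) \<cdot> Inv V (LUnit V (Cod V a))"

definition insert_right :: "'m \<Rightarrow> 'm \<Rightarrow> 'm" where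
  "insert_right m b = m \<cdot> (Id V (Cod V b) \<otimes> b) \<cdot> Inv V (RUnit V (Cod V b))"

lemma insert_hom:
  assumes "m \<in> hom V (Q \<otimes>\<^sub>o Q) A" "a \<in> hom V \<I> Q"
  shows "insert_left m a \<in> hom V Q A" "insert_right m a \<in> hom V Q A"
  using homD[OF assms(1)] homD[OF assms(2)] by (auto simp: insert_left_def insert_right_def hom_def)

lemma insert_point:
  assumes "m \<in> hom V (Q \<otimes>\<^sub>o Q) A" "a \<in> hom V \<I> Q" "b \<in> hom V \<I> Q"
  shows "insert_left m a \<cdot> b = m \<cdot> (a \<otimes>\<^sub>p b)" "insert_right m b \<cdot> a = m \<cdot> (a \<otimes>\<^sub>p b)"
proof -
  note [simp] = homD[OF assms(1)] homD[OF assms(2)] homD[OF assms(3)]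
  have "insert_left m a \<cdot> b = m \<cdot> (a \<otimes> Id V Q) \<cdot> Inv V (LUnit V Q) \<cdot> b"
    by (simp add: insert_left_def)
  then show "insert_left m a \<cdot> b = m \<cdot> (a \<otimes>\<^sub>p b)"
    by (simp add: Inv_LUnit_nat[OF assms(3), symmetric] point_tensor_def)
  have "insert_right m b \<cdot> a = m \<cdot> (Id V Q \<otimes> b) \<cdot> Inv V (RUnit V Q) \<cdot> a"
    by (simp add: insert_right_def)
  then show "insert_right m b \<cdot> a = m \<cdot> (a \<otimes>\<^sub>p b)"
    by (simp add: Inv_RUnit_nat[OF assms(2), symmetric] point_tensor_def LUnit_eq_RUnit)
qed

lemma plugging_eq:
  assumes "plugging_set V Q P" "f \<in> hom V Q A" "g \<in> hom V Q A" "\<And>p. p \<in> P \<Longrightarrow> f \<cdot> p = g \<cdot> p"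
  shows "f = g"
  using assms homD[OF assms(2)] unfolding plugging_set_def by blast

text \<open>The arguments are freed one after the other: plugging in the second slot makes it
  arbitrary while the first stays in \<open>P\<close>, and plugging in the first slot then
  finishes.\<close>

lemma plugging_eq2:
  assumes P: "plugging_set V Q P"
    and f: "f \<in> hom V (Q \<otimes>\<^sub>o Q) A" and g: "g \<in> hom V (Q \<otimes>\<^sub>o Q) A"
    and eq: "\<And>p q. p \<in> P \<Longrightarrow> q \<in> P \<Longrightarrow> f \<cdot> (p \<otimes>\<^sub>p q) = g \<cdot> (p \<otimes>\<^sub>p q)"
    and a: "a \<in> hom V \<I> Q" and b: "b \<in> hom V \<I> Q"
  shows "f \<cdot> (a \<otimes>\<^sub>p b) = g \<cdot> (a \<otimes>\<^sub>p b)"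
proof -
  have PQ: "p \<in> hom V \<I> Q" if "p \<in> P" for p
    using P that by (auto simp: plugging_set_def)
  have "insert_left f p = insert_left g p" if p: "p \<in> P" for p
    by (rule plugging_eq[OF P insert_hom(1)[OF f] insert_hom(1)[OF g]])
      (simp_all add: insert_point(1)[OF f] insert_point(1)[OF g] PQ p eq)
  then have pb: "f \<cdot> (p \<otimes>\<^sub>p b) = g \<cdot> (p \<otimes>\<^sub>p b)" if "p \<in> P" for p
    using that insert_point(1)[OF f PQ b] insert_point(1)[OF g PQ b] by metis
  have "insert_right f b = insert_right g b"
    by (rule plugging_eq[OF P insert_hom(2)[OF f] insert_hom(2)[OF g]])
      (simp_all add: insert_point(2)[OF f] insert_point(2)[OF g] PQ b pb)
  then show ?thesis
    using insert_point(2)[OF f a b] insert_point(2)[OF g a b] by metis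
qed

end

section \<open>Frobenius algebras evaluated on points\<close>

locale frobenius_algebra = monoidal_category V
  for V :: "('o, 'm, 'z) smc_data_scheme" (structure) +
  fixes Q :: 'o and \<mu> \<eta> \<delta> \<epsilon> :: 'm
  assumes Q_Obj: "Q \<in> Obj V" and CFA: "CFA V Q \<mu> \<eta> \<delta> \<epsilon>"
begin

lemma structure_hom:
  "\<mu> \<in> hom V (Q \<otimes>\<^sub>o Q) Q" "\<eta> \<in> hom V \<I> Q" "\<delta> \<in> hom V Q (Q \<otimes>\<^sub>o Q)" "\<epsilon> \<in> hom V Q \<I>"
  using CFA by (auto simp: CFA_def commutative_monoid_def cocommutative_comonoid_def)

lemmas structure_homD [simp] =
  structure_hom[THEN homD(1)] structure_hom[THEN homD(2)] structure_hom[THEN homD(3)] Q_Obj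

lemma units: "\<mu> \<cdot> (\<eta> \<otimes> Id V Q) = LUnit V Q" "\<mu> \<cdot> (Id V Q \<otimes> \<eta>) = RUnit V Q"
  and counits: "LUnit V Q \<cdot> (\<epsilon> \<otimes> Id V Q) \<cdot> \<delta> = Id V Q" "RUnit V Q \<cdot> (Id V Q \<otimes> \<epsilon>) \<cdot> \<delta> = Id V Q"
  and frobenius: "(Id V Q \<otimes> \<mu>) \<cdot> Assoc V Q Q Q \<cdot> (\<delta> \<otimes> Id V Q) = \<delta> \<cdot> \<mu>"
    "(\<mu> \<otimes> Id V Q) \<cdot> Inv V (Assoc V Q Q Q) \<cdot> (Id V Q \<otimes> \<delta>) = \<delta> \<cdot> \<mu>"
  using CFA by (simp_all add: CFA_def commutative_monoid_def cocommutative_comonoid_def)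

lemma unit_left:
  assumes "p \<in> hom V \<I> Q"
  shows "\<mu> \<cdot> (\<eta> \<otimes>\<^sub>p p) = p"
proof -
  note [simp] = homD[OF assms]
  have "\<mu> \<cdot> (\<eta> \<otimes>\<^sub>p p) = (\<mu> \<cdot> (\<eta> \<otimes> Id V Q)) \<cdot> (Id V \<I> \<otimes>\<^sub>p p)"
    by simp
  also have "\<dots> = p"
    unfolding units using LUnit_point_tensor[OF Id_hom assms] by simp
  finally show ?thesis .
qed

lemma unit_right:
  assumes "p \<in> hom V \<I> Q"
  shows "\<mu> \<cdot> (p \<otimes>\<^sub>p \<eta>) = p"
proof -
  note [simp] = homD[OF assms]
  have "\<mu> \<cdot> (p \<otimes>\<^sub>p \<eta>) = (\<mu> \<cdot> (Id V Q \<otimes> \<eta>)) \<cdot> (p \<otimes>\<^sub>p Id V \<I>)"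
    by simp
  also have "\<dots> = p"
    unfolding units using RUnit_point_tensor[OF Id_hom assms] by simp
  finally show ?thesis .
qed

text \<open>Commutativity on points follows from the unit laws and plugging, so that no coherence for the
  symmetry is needed.\<close>

lemma mult_commute:
  assumes P: "plugging_set V Q {\<eta>, w}"
    and a: "a \<in> hom V \<I> Q" and b: "b \<in> hom V \<I> Q"
  shows "\<mu> \<cdot> (a \<otimes>\<^sub>p b) = \<mu> \<cdot> (b \<otimes>\<^sub>p a)"
proof -
  note m = structure_hom(1)
  have w: "w \<in> hom V \<I> Q"
    using P by (auto simp: plugging_set_def)
  have eta: "insert_left \<mu> \<eta> = insert_right \<mu> \<eta>"
    by (rule plugging_eq[OF P insert_hom(1)[OF m] insert_hom(2)[OF m]])
      (auto simp: insert_point[OF m] structure_hom w unit_left unit_right)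
  \<comment> \<open>At \<open>\<eta>\<close> the unit laws decide, and at \<open>w\<close> both
    sides are \<open>\<mu> \<cdot> (w \<otimes>\<^sub>p w)\<close>.\<close>
  have "insert_left \<mu> w = insert_right \<mu> w"
    by (rule plugging_eq[OF P insert_hom(1)[OF m] insert_hom(2)[OF m]])
      (auto simp: insert_point[OF m] structure_hom w unit_left unit_right)
  then have *: "\<mu> \<cdot> (p \<otimes>\<^sub>p b) = \<mu> \<cdot> (b \<otimes>\<^sub>p p)" if "p \<in> {\<eta>, w}" for p
    using that eta insert_point[OF m, of p b] insert_point[OF m, of b p] structure_hom(2) w b
    by auto
  have "insert_right \<mu> b = insert_left \<mu> b"
    by (rule plugging_eq[OF P insert_hom(2)[OF m] insert_hom(1)[OF m]])
      (use * in \<open>auto simp: insert_point[OF m] structure_hom w b\<close>)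
  then show ?thesis
    using insert_point[OF m a b] insert_point[OF m b a] by metis
qed

text \<open>Insert the counit law after the product and move \<open>\<delta>\<close> onto
  \<open>p\<close> by the Frobenius law. Copying then leaves one \<open>p\<close> as output, while
  the other is multiplied with \<open>q\<close> and capped by \<open>\<epsilon>\<close>.\<close>

lemma copyable_mult:
  assumes p: "p \<in> hom V \<I> Q" and q: "q \<in> hom V \<I> Q" and copy: "\<delta> \<cdot> p = p \<otimes>\<^sub>p p"
  shows "\<mu> \<cdot> (p \<otimes>\<^sub>p q) = p \<cdot> \<epsilon> \<cdot> \<mu> \<cdot> (p \<otimes>\<^sub>p q)"
proof -
  note [simp] = homD[OF p] homD[OF q]
  let ?l = "Inv V (LUnit V \<I>)"
  \<comment> \<open>Rebracketing three points involves two inverse unitors; the triangle at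
    \<open>\<I>\<close> shows that the associator there merely moves one of them to the other
    side.\<close>
  have tri: "Assoc V \<I> \<I> \<I> \<cdot> (?l \<otimes> Id V \<I>) = Id V \<I> \<otimes> ?l"
  proof -
    have "Assoc V \<I> \<I> \<I> \<cdot> (?l \<otimes> Id V \<I>) =
        (Id V \<I> \<otimes> (?l \<cdot> LUnit V \<I>)) \<cdot> Assoc V \<I> \<I> \<I> \<cdot> (?l \<otimes> Id V \<I>)"
      by simp
    also have "\<dots> = (Id V \<I> \<otimes> ?l) \<cdot> ((Id V \<I> \<otimes> LUnit V \<I>) \<cdot> Assoc V \<I> \<I> \<I>) \<cdot> (?l \<otimes> Id V \<I>)"
      by (simp del: structure_arr(14))
    also have "\<dots> = (Id V \<I> \<otimes> ?l) \<cdot> (LUnit V \<I> \<otimes> Id V \<I>) \<cdot> (?l \<otimes> Id V \<I>)"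
      by (simp only: triangle UnitObj_Obj LUnit_eq_RUnit[symmetric])
    also have "\<dots> = Id V \<I> \<otimes> ?l"
      by simp
    finally show ?thesis .
  qed
  have "Assoc V Q Q Q \<cdot> ((p \<otimes>\<^sub>p p) \<otimes>\<^sub>p q) = Assoc V Q Q Q \<cdot> ((p \<otimes> p) \<otimes> q) \<cdot> (?l \<otimes> Id V \<I>) \<cdot> ?l"
    by (simp add: point_tensor_def)
  also have "\<dots> = (Assoc V Q Q Q \<cdot> ((p \<otimes> p) \<otimes> q)) \<cdot> (?l \<otimes> Id V \<I>) \<cdot> ?l"
    by (simp del: interchange interchange_Comp)
  also have "\<dots> = (p \<otimes> p \<otimes> q) \<cdot> (Assoc V \<I> \<I> \<I> \<cdot> (?l \<otimes> Id V \<I>)) \<cdot> ?l"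
    using Assoc_nat[of p p q] by simp
  also have "\<dots> = p \<otimes>\<^sub>p p \<otimes>\<^sub>p q"
    unfolding tri by (simp add: point_tensor_def)
  finally have assoc: "Assoc V Q Q Q \<cdot> ((p \<otimes>\<^sub>p p) \<otimes>\<^sub>p q) = p \<otimes>\<^sub>p p \<otimes>\<^sub>p q" .
  have "\<mu> \<cdot> (p \<otimes>\<^sub>p q) = (RUnit V Q \<cdot> (Id V Q \<otimes> \<epsilon>) \<cdot> \<delta>) \<cdot> \<mu> \<cdot> (p \<otimes>\<^sub>p q)"
    by (simp only: counits) simp
  also have "\<dots> = RUnit V Q \<cdot> (Id V Q \<otimes> \<epsilon>) \<cdot> (\<delta> \<cdot> \<mu>) \<cdot> (p \<otimes>\<^sub>p q)"
    by simp
  also have "\<dots> = RUnit V Q \<cdot> (Id V Q \<otimes> (\<epsilon> \<cdot> \<mu>)) \<cdot> Assoc V Q Q Q \<cdot> ((p \<otimes>\<^sub>p p) \<otimes>\<^sub>p q)"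
    by (simp add: frobenius(1)[symmetric] copy)
  also have "\<dots> = RUnit V Q \<cdot> (p \<otimes>\<^sub>p (\<epsilon> \<cdot> \<mu> \<cdot> (p \<otimes>\<^sub>p q)))"
    unfolding assoc by simp
  also have "\<dots> = p \<cdot> \<epsilon> \<cdot> \<mu> \<cdot> (p \<otimes>\<^sub>p q)"
    by (rule RUnit_point_tensor) (simp_all add: hom_def)
  finally show ?thesis .
qed

text \<open>The case \<open>q = \<eta>\<close> of \<open>copyable_mult\<close>. The scalar
  \<open>\<epsilon> \<cdot> p\<close> is only claimed to act trivially on \<open>p\<close>, not to
  be the identity.\<close>

lemma copyable_absorb:
  assumes p: "p \<in> hom V \<I> Q" and copy: "\<delta> \<cdot> p = p \<otimes>\<^sub>p p"
  shows "p \<cdot> \<epsilon> \<cdot> p = p"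
  using copyable_mult[OF p structure_hom(2) copy] unfolding unit_right[OF p] by (rule sym)

text \<open>The point slides through the coherence isomorphisms into the first leg of
  \<open>\<mu>'\<close>. What remains is a functional applied to the left leg of the cup
  \<open>\<delta> \<cdot> \<eta>\<close>.\<close>

lemma cap_cup_point:
  assumes e': "\<epsilon>' \<in> hom V Q \<I>" and m': "\<mu>' \<in> hom V (Q \<otimes>\<^sub>o Q) Q" and a: "a \<in> hom V \<I> Q"
  shows "cap_cup V Q \<epsilon>' \<mu>' \<delta> \<eta> \<cdot> a = LUnit V Q \<cdot> (insert_left (\<epsilon>' \<cdot> \<mu>') a \<otimes> Id V Q) \<cdot> \<delta> \<cdot> \<eta>"
proof -
  note [simp] = homD[OF e'] homD[OF m'] homD[OF a]
  let ?m = "\<epsilon>' \<cdot> \<mu>'" and ?f = "insert_left (\<epsilon>' \<cdot> \<mu>') a"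
  have f: "?f \<in> hom V Q \<I>"
    by (rule insert_hom(1)[OF _ a]) (simp add: hom_def)
  note [simp] = homD[OF f]
  have fl: "?f \<cdot> LUnit V Q = ?m \<cdot> (a \<otimes> Id V Q)"
    by (simp add: insert_left_def)
  have "Inv V (Assoc V Q Q Q) \<cdot> (a \<otimes> Id V (Q \<otimes>\<^sub>o Q)) =
      Inv V (Assoc V Q Q Q) \<cdot> ((a \<otimes> Id V Q \<otimes> Id V Q) \<cdot> Assoc V \<I> Q Q) \<cdot> Inv V (Assoc V \<I> Q Q)"
    by simp
  also have "\<dots> = Inv V (Assoc V Q Q Q) \<cdot> (Assoc V Q Q Q \<cdot> ((a \<otimes> Id V Q) \<otimes> Id V Q)) \<cdot> Inv V (Assoc V \<I> Q Q)"
    using Assoc_nat[of a "Id V Q" "Id V Q"] by simp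
  also have "\<dots> = (Inv V (Assoc V Q Q Q) \<cdot> Assoc V Q Q Q) \<cdot> ((a \<otimes> Id V Q) \<otimes> Id V Q) \<cdot> Inv V (Assoc V \<I> Q Q)"
    by (simp del: Assoc_arr(8))
  also have "\<dots> = ((a \<otimes> Id V Q) \<otimes> Id V Q) \<cdot> Inv V (Assoc V \<I> Q Q)"
    by simp
  finally have assoc: "Inv V (Assoc V Q Q Q) \<cdot> (a \<otimes> Id V (Q \<otimes>\<^sub>o Q)) =
    ((a \<otimes> Id V Q) \<otimes> Id V Q) \<cdot> Inv V (Assoc V \<I> Q Q)" .
  have "cap_cup V Q \<epsilon>' \<mu>' \<delta> \<eta> \<cdot> a =
      LUnit V Q \<cdot> (?m \<otimes> Id V Q) \<cdot> Inv V (Assoc V Q Q Q) \<cdot> (Id V Q \<otimes> (\<delta> \<cdot> \<eta>)) \<cdot> Inv V (RUnit V Q) \<cdot> a"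
    by (simp add: cap_cup_def)
  also have "\<dots> = LUnit V Q \<cdot> (?m \<otimes> Id V Q) \<cdot> (Inv V (Assoc V Q Q Q) \<cdot> (a \<otimes> Id V (Q \<otimes>\<^sub>o Q)))
      \<cdot> (Id V \<I> \<otimes> (\<delta> \<cdot> \<eta>)) \<cdot> Inv V (RUnit V \<I>)"
    by (simp add: Inv_RUnit_nat[OF a, symmetric])
  also have "\<dots> = LUnit V Q \<cdot> ((?f \<cdot> LUnit V Q) \<otimes> Id V Q) \<cdot> Inv V (Assoc V \<I> Q Q)
      \<cdot> (Id V \<I> \<otimes> (\<delta> \<cdot> \<eta>)) \<cdot> Inv V (RUnit V \<I>)"
    unfolding assoc fl by simp
  also have "\<dots> = LUnit V Q \<cdot> (?f \<otimes> Id V Q) \<cdot> (LUnit V Q \<otimes> Id V Q) \<cdot> Inv V (Assoc V \<I> Q Q)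
      \<cdot> (Id V \<I> \<otimes> (\<delta> \<cdot> \<eta>)) \<cdot> Inv V (LUnit V \<I>)"
    by (simp add: LUnit_eq_RUnit)
  \<comment> \<open>\<open>LUnit_TObj\<close> trades the left unitor on one factor for the one on
    the whole product, and the associator it introduces cancels the inverse one.\<close>
  also have "\<dots> = LUnit V Q \<cdot> (?f \<otimes> Id V Q) \<cdot> LUnit V (Q \<otimes>\<^sub>o Q) \<cdot> (Assoc V \<I> Q Q \<cdot> Inv V (Assoc V \<I> Q Q))
      \<cdot> (Id V \<I> \<otimes> (\<delta> \<cdot> \<eta>)) \<cdot> Inv V (LUnit V \<I>)"
    by (simp add: LUnit_TObj[symmetric] del: Assoc_arr(7))
  also have "\<dots> = LUnit V Q \<cdot> (?f \<otimes> Id V Q) \<cdot> (LUnit V (Q \<otimes>\<^sub>o Q) \<cdot> (Id V \<I> \<otimes> (\<delta> \<cdot> \<eta>))) \<cdot> Inv V (LUnit V \<I>)"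
    by simp
  also have "\<dots> = LUnit V Q \<cdot> (?f \<otimes> Id V Q) \<cdot> \<delta> \<cdot> \<eta>"
    using LUnit_nat[of "\<delta> \<cdot> \<eta>"] by simp
  finally show ?thesis .
qed

text \<open>A snake identity: the algebra's own cap straightens the cup inside
  \<open>cap_cup\<close>, leaving the foreign cap. Used in both algebras, it exchanges white and
  black pairings.\<close>

lemma cap_cap_cup:
  assumes e': "\<epsilon>' \<in> hom V Q \<I>" and m': "\<mu>' \<in> hom V (Q \<otimes>\<^sub>o Q) Q"
    and a: "a \<in> hom V \<I> Q" and b: "b \<in> hom V \<I> Q"
  shows "\<epsilon> \<cdot> \<mu> \<cdot> ((cap_cup V Q \<epsilon>' \<mu>' \<delta> \<eta> \<cdot> a) \<otimes>\<^sub>p b) = \<epsilon>' \<cdot> \<mu>' \<cdot> (a \<otimes>\<^sub>p b)"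
proof -
  note [simp] = homD[OF e'] homD[OF m'] homD[OF a] homD[OF b]
  let ?f = "insert_left (\<epsilon>' \<cdot> \<mu>') a"
  have m: "\<epsilon>' \<cdot> \<mu>' \<in> hom V (Q \<otimes>\<^sub>o Q) \<I>"
    by (simp add: hom_def)
  have f: "?f \<in> hom V Q \<I>"
    by (rule insert_hom(1)[OF m a])
  note [simp] = homD[OF f]
  have "\<mu> \<cdot> ((cap_cup V Q \<epsilon>' \<mu>' \<delta> \<eta> \<cdot> a) \<otimes>\<^sub>p b) =
      \<mu> \<cdot> (LUnit V Q \<otimes> Id V Q) \<cdot> ((?f \<otimes> Id V Q) \<otimes> Id V Q) \<cdot> (\<delta> \<otimes> Id V Q) \<cdot> (\<eta> \<otimes>\<^sub>p b)"
    by (simp add: cap_cup_point[OF e' m' a])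
  also have "\<dots> = \<mu> \<cdot> LUnit V (Q \<otimes>\<^sub>o Q) \<cdot> (Assoc V \<I> Q Q \<cdot> ((?f \<otimes> Id V Q) \<otimes> Id V Q)) \<cdot> (\<delta> \<otimes> Id V Q) \<cdot> (\<eta> \<otimes>\<^sub>p b)"
    by (simp add: LUnit_TObj[symmetric] del: interchange interchange_Comp tensor_point_tensor)
  also have "\<dots> = (\<mu> \<cdot> LUnit V (Q \<otimes>\<^sub>o Q)) \<cdot> (?f \<otimes> Id V (Q \<otimes>\<^sub>o Q)) \<cdot> Assoc V Q Q Q \<cdot> (\<delta> \<otimes> Id V Q) \<cdot> (\<eta> \<otimes>\<^sub>p b)"
    using Assoc_nat[of ?f "Id V Q" "Id V Q"]
    by (simp del: interchange interchange_Comp tensor_point_tensor)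
  \<comment> \<open>By the Frobenius law the copy of \<open>\<eta>\<close> multiplied by
    \<open>b\<close> is the copy of the product of \<open>\<eta>\<close> and \<open>b\<close>, hence
    of \<open>b\<close>.\<close>
  also have "\<dots> = LUnit V Q \<cdot> (?f \<otimes> Id V Q) \<cdot> ((Id V Q \<otimes> \<mu>) \<cdot> Assoc V Q Q Q \<cdot> (\<delta> \<otimes> Id V Q)) \<cdot> (\<eta> \<otimes>\<^sub>p b)"
    using LUnit_nat[of \<mu>, symmetric] by simp
  also have "\<dots> = LUnit V Q \<cdot> (?f \<otimes> Id V Q) \<cdot> \<delta> \<cdot> b"
    unfolding frobenius by (simp add: unit_left[OF b])
  finally have "\<epsilon> \<cdot> \<mu> \<cdot> ((cap_cup V Q \<epsilon>' \<mu>' \<delta> \<eta> \<cdot> a) \<otimes>\<^sub>p b) =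
      (\<epsilon> \<cdot> LUnit V Q) \<cdot> (?f \<otimes> Id V Q) \<cdot> \<delta> \<cdot> b"
    by simp
  also have "\<dots> = (RUnit V \<I> \<cdot> (?f \<otimes> Id V \<I>)) \<cdot> (Id V Q \<otimes> \<epsilon>) \<cdot> \<delta> \<cdot> b"
    using LUnit_nat[of \<epsilon>, symmetric] by (simp add: LUnit_eq_RUnit)
  also have "\<dots> = ?f \<cdot> (RUnit V Q \<cdot> (Id V Q \<otimes> \<epsilon>) \<cdot> \<delta>) \<cdot> b"
    using RUnit_nat[of ?f] by simp
  also have "\<dots> = ?f \<cdot> b"
    unfolding counits by simp
  finally show ?thesis
    using insert_point(1)[OF m a b] by simp
qed

lemma cap_cup_self:
  assumes a: "a \<in> hom V \<I> Q"
  shows "cap_cup V Q \<epsilon> \<mu> \<delta> \<eta> \<cdot> a = a"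
proof -
  note [simp] = homD[OF a]
  have "cap_cup V Q \<epsilon> \<mu> \<delta> \<eta> \<cdot> a = LUnit V Q \<cdot> ((\<epsilon> \<cdot> \<mu>) \<otimes> Id V Q) \<cdot> Inv V (Assoc V Q Q Q)
      \<cdot> (Id V Q \<otimes> (\<delta> \<cdot> \<eta>)) \<cdot> Inv V (RUnit V Q) \<cdot> a"
    by (simp add: cap_cup_def)
  also have "\<dots> = LUnit V Q \<cdot> (\<epsilon> \<otimes> Id V Q) \<cdot> ((\<mu> \<otimes> Id V Q) \<cdot> Inv V (Assoc V Q Q Q) \<cdot> (Id V Q \<otimes> \<delta>))
      \<cdot> (a \<otimes>\<^sub>p \<eta>)"
    by (simp add: Inv_RUnit_nat[OF a, symmetric] point_tensor_def LUnit_eq_RUnit)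
  also have "\<dots> = (LUnit V Q \<cdot> (\<epsilon> \<otimes> Id V Q) \<cdot> \<delta>) \<cdot> a"
    unfolding frobenius by (simp add: unit_right[OF a])
  also have "\<dots> = a"
    unfolding counits by simp
  finally show ?thesis .
qed

text \<open>By \<open>cap_cup_point\<close> the bent wire sees \<open>a\<close> only through the
  functional \<open>insert_left (\<epsilon> \<cdot> \<mu>) a\<close>, and by
  \<open>cap_cup_self\<close> it returns \<open>a\<close>. Equality of these functionals is tested
  on \<open>P\<close>.\<close>

lemma cap_nondegenerate:
  assumes P: "plugging_set V Q P" and a: "a \<in> hom V \<I> Q" and b: "b \<in> hom V \<I> Q"
    and eq: "\<And>p. p \<in> P \<Longrightarrow> \<epsilon> \<cdot> \<mu> \<cdot> (a \<otimes>\<^sub>p p) = \<epsilon> \<cdot> \<mu> \<cdot> (b \<otimes>\<^sub>p p)"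
  shows "a = b"
proof -
  note [simp] = homD[OF a] homD[OF b]
  have m: "\<epsilon> \<cdot> \<mu> \<in> hom V (Q \<otimes>\<^sub>o Q) \<I>"
    by (simp add: hom_def)
  have PQ: "p \<in> hom V \<I> Q" if "p \<in> P" for p
    using P that by (auto simp: plugging_set_def)
  have "insert_left (\<epsilon> \<cdot> \<mu>) a = insert_left (\<epsilon> \<cdot> \<mu>) b"
  proof (rule plugging_eq[OF P insert_hom(1)[OF m a] insert_hom(1)[OF m b]])
    fix p assume p: "p \<in> P"
    show "insert_left (\<epsilon> \<cdot> \<mu>) a \<cdot> p = insert_left (\<epsilon> \<cdot> \<mu>) b \<cdot> p"
      using eq[OF p] homD[OF PQ[OF p]]
      by (simp add: insert_point(1)[OF m a PQ[OF p]] insert_point(1)[OF m b PQ[OF p]])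
  qed
  then show ?thesis
    using cap_cup_point[OF structure_hom(4,1) a] cap_cup_point[OF structure_hom(4,1) b]
      cap_cup_self[OF a] cap_cup_self[OF b] by metis
qed

end

section \<open>Additive inverses in a GHZ/W-pair\<close>

theorem theorem4p4:
  fixes V :: "('o, 'm) smc_data" (structure)
    and Q :: 'o
    and \<mu>w \<eta>w \<delta>w \<epsilon>w \<mu>b \<eta>b \<delta>b \<epsilon>b x \<psi> :: 'm
  assumes "symmetric_monoidal_category V"
    and "no_nontrivial_invertible_scalars V"
    and "Q \<in> Obj V"
    and "GHZ_W_pair V Q \<mu>w \<eta>w \<delta>w \<epsilon>w \<mu>b \<eta>b \<delta>b \<epsilon>b"
    and "plugging_set V Q {\<eta>b, tau V Q \<eta>w \<delta>w \<mu>b \<epsilon>b \<cdot> \<eta>b}"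
    and "x \<in> hom V Q Q"
    and "x \<cdot> x = Id V Q"
    and "x \<cdot> \<mu>w = \<mu>w \<cdot> (x \<otimes> Id V Q)"
    and "plugging_set V Q {\<eta>w, x \<cdot> \<eta>w}"
    and "\<psi> \<in> hom V \<I> Q"
  shows "\<mu>b \<cdot> (\<psi> \<otimes>\<^sub>p (x \<cdot> \<psi>)) = (\<epsilon>w \<cdot> \<mu>b \<cdot> (\<psi> \<otimes>\<^sub>p (x \<cdot> \<psi>))) \<star> \<eta>b"
proof -
  interpret symmetric_monoidal_category V
    by (rule assms(1))
  have ghz: "CFA V Q \<mu>w \<eta>w \<delta>w \<epsilon>w" and w: "CFA V Q \<mu>b \<eta>b \<delta>b \<epsilon>b"
    using assms(4) by (auto simp: GHZ_W_pair_def GHZ_structure_def W_structure_def)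
  interpret w: frobenius_algebra V Q \<mu>w \<eta>w \<delta>w \<epsilon>w
    by unfold_locales (use assms(3) ghz in auto)
  interpret b: frobenius_algebra V Q \<mu>b \<eta>b \<delta>b \<epsilon>b
    by unfold_locales (use assms(3) w in auto)
  define \<tau> where "\<tau> = tau V Q \<eta>w \<delta>w \<mu>b \<epsilon>b"
  define u where "u = \<tau> \<cdot> \<eta>b"
  have tau1: "\<tau> = cap_cup V Q \<epsilon>b \<mu>b \<delta>w \<eta>w"
    by (simp add: \<tau>_def tau_def)
  have tau2: "\<tau> = cap_cup V Q \<epsilon>w \<mu>w \<delta>b \<eta>b"
    and copy_z: "\<delta>w \<cdot> \<eta>b = \<eta>b \<otimes>\<^sub>p \<eta>b"
    and copy_tau: "\<delta>w \<cdot> \<tau> = (\<tau> \<otimes> \<tau>) \<cdot> \<delta>w"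
    using assms(4) by (auto simp: GHZ_W_pair_def Let_def \<tau>_def)
  have Pb: "plugging_set V Q {\<eta>b, u}"
    using assms(5) by (simp add: u_def \<tau>_def)
  have \<tau>: "\<tau> \<in> hom V Q Q"
    by (simp add: tau1 cap_cup_def hom_def)
  note x = assms(6) and \<psi> = assms(10)
  note [simp] = homD[OF x] homD[OF \<tau>] homD[OF \<psi>]
  note z = b.structure_hom(2)
  have u: "u \<in> hom V \<I> Q"
    by (simp add: u_def hom_def)
  note [simp] = homD[OF u]
  have copy_u: "\<delta>w \<cdot> u = u \<otimes>\<^sub>p u"
  proof -
    have "\<delta>w \<cdot> u = (\<delta>w \<cdot> \<tau>) \<cdot> \<eta>b"
      by (simp add: u_def)
    also have "\<dots> = u \<otimes>\<^sub>p u"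
      unfolding copy_tau by (simp add: copy_z u_def)
    finally show ?thesis .
  qed
  have w_commute: "\<mu>w \<cdot> (a \<otimes>\<^sub>p b) = \<mu>w \<cdot> (b \<otimes>\<^sub>p a)" if "a \<in> hom V \<I> Q" "b \<in> hom V \<I> Q" for a b
    using w.mult_commute[OF assms(9) that] .
  have b_commute: "\<mu>b \<cdot> (a \<otimes>\<^sub>p b) = \<mu>b \<cdot> (b \<otimes>\<^sub>p a)" if "a \<in> hom V \<I> Q" "b \<in> hom V \<I> Q" for a b
    using b.mult_commute[OF Pb that] .
  have cap_w: "\<epsilon>w \<cdot> \<mu>w \<cdot> (u \<otimes>\<^sub>p a) = \<epsilon>b \<cdot> a" if "a \<in> hom V \<I> Q" for a
    using w.cap_cap_cup[OF b.structure_hom(4,1) z that] b.unit_left[OF that]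
    by (simp add: u_def tau1)
  \<comment> \<open>Here the second expression for \<open>\<tau>\<close> is used, so the roles of
    the two algebras are swapped; the white product with \<open>\<eta>b\<close> does not simplify
    further.\<close>
  have cap_b: "\<epsilon>b \<cdot> \<mu>b \<cdot> (u \<otimes>\<^sub>p a) = \<epsilon>w \<cdot> \<mu>w \<cdot> (\<eta>b \<otimes>\<^sub>p a)" if "a \<in> hom V \<I> Q" for a
    using b.cap_cap_cup[OF w.structure_hom(4,1) z that] by (simp add: u_def tau2)
  have x_mult: "x \<cdot> \<mu>w \<cdot> (a \<otimes>\<^sub>p b) = \<mu>w \<cdot> ((x \<cdot> a) \<otimes>\<^sub>p b)"
    if "a \<in> hom V \<I> Q" "b \<in> hom V \<I> Q" for a b
  proof -
    note [simp] = homD[OF that(1)] homD[OF that(2)]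
    have "x \<cdot> \<mu>w \<cdot> (a \<otimes>\<^sub>p b) = (x \<cdot> \<mu>w) \<cdot> (a \<otimes>\<^sub>p b)"
      by simp
    then show ?thesis
      unfolding assms(8) by simp
  qed
  have x_x: "x \<cdot> x \<cdot> a = a" if "a \<in> hom V \<I> Q" for a
    using Comp_assoc[OF that x x] Comp_Id_left[OF that] assms(7) by simp
  have x_point: "x \<cdot> a \<in> hom V \<I> Q" if "a \<in> hom V \<I> Q" for a
    using Comp_hom[OF that x] .
  note xw = x_point[OF w.structure_hom(2)]
  have x_move: "\<mu>w \<cdot> ((x \<cdot> a) \<otimes>\<^sub>p b) = \<mu>w \<cdot> (a \<otimes>\<^sub>p (x \<cdot> b))"
    if "a \<in> hom V \<I> Q" "b \<in> hom V \<I> Q" for a b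
    by (metis x_mult w_commute x_point that)

  \<comment> \<open>Scalars by which the involution acts on copyable points\<close>
  have eigen: "\<exists>r \<in> hom V \<I> \<I>. x \<cdot> p = p \<cdot> r"
    if p: "p \<in> hom V \<I> Q" "\<delta>w \<cdot> p = p \<otimes>\<^sub>p p" for p
  proof
    note [simp] = homD[OF p(1)]
    \<comment> \<open>The witness, fixed by unification in the next goal, is the white pairing of
      \<open>p\<close> with \<open>x \<cdot> \<eta>w\<close>.\<close>
    have "x \<cdot> p = \<mu>w \<cdot> (p \<otimes>\<^sub>p (x \<cdot> \<eta>w))"
      using w.unit_right[OF x_point[OF p(1)]] x_move[OF p(1) w.structure_hom(2)] by simp
    then show "x \<cdot> p = p \<cdot> \<epsilon>w \<cdot> \<mu>w \<cdot> (p \<otimes>\<^sub>p (x \<cdot> \<eta>w))"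
      using w.copyable_mult[OF p(1) xw p(2)] by simp
    show "\<epsilon>w \<cdot> \<mu>w \<cdot> (p \<otimes>\<^sub>p (x \<cdot> \<eta>w)) \<in> hom V \<I> \<I>"
      by (simp add: hom_def)
  qed
  obtain s where s: "s \<in> hom V \<I> \<I>" and xz: "x \<cdot> \<eta>b = \<eta>b \<cdot> s"
    using eigen[OF z copy_z] by blast
  obtain t where t: "t \<in> hom V \<I> \<I>" and xu: "x \<cdot> u = u \<cdot> t"
    using eigen[OF u copy_u] by blast
  note [simp] = homD[OF s] homD[OF t]
  have xx_scalar: "p \<cdot> r \<cdot> r = p" if "x \<cdot> p = p \<cdot> r" "p \<in> hom V \<I> Q" "r \<in> hom V \<I> \<I>" for p r
  proof -
    note [simp] = homD[OF that(2)] homD[OF that(3)]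
    have "p = x \<cdot> p \<cdot> r"
      unfolding that(1)[symmetric] by (rule x_x[OF that(2), symmetric])
    also have "\<dots> = (x \<cdot> p) \<cdot> r"
      by simp
    also have "\<dots> = p \<cdot> r \<cdot> r"
      unfolding that(1) by simp
    finally show ?thesis ..
  qed
  \<comment> \<open>Every point is a black product with \<open>\<eta>b\<close>, so a scalar acting
    trivially on \<open>\<eta>b\<close> acts trivially on all points.\<close>
  have absorb: "a \<cdot> r = a" if "\<eta>b \<cdot> r = \<eta>b" "r \<in> hom V \<I> \<I>" "a \<in> hom V \<I> Q" for a r
  proof -
    note [simp] = homD[OF that(2)] homD[OF that(3)]
    have "a \<cdot> r = (\<mu>b \<cdot> (\<eta>b \<otimes>\<^sub>p a)) \<cdot> r"
      by (simp only: b.unit_left[OF that(3)])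
    also have "\<dots> = \<mu>b \<cdot> ((\<eta>b \<cdot> r) \<otimes>\<^sub>p a)"
      by (simp add: point_tensor_scalar_left[OF z that(3,2)])
    also have "\<dots> = a"
      by (simp only: that(1) b.unit_left[OF that(3)])
    finally show ?thesis .
  qed
  have ss: "a \<cdot> s \<cdot> s = a" if "a \<in> hom V \<I> Q" for a
    by (rule absorb[OF xx_scalar[OF xz z s] _ that]) (simp add: hom_def)
  have zez: "a \<cdot> \<epsilon>w \<cdot> \<eta>b = a" if "a \<in> hom V \<I> Q" for a
    by (rule absorb[OF w.copyable_absorb[OF z copy_z] _ that]) (simp add: hom_def)

  \<comment> \<open>The white pairing of the two black plugging points\<close>
  define k where "k = \<epsilon>w \<cdot> \<mu>w \<cdot> (\<eta>b \<otimes>\<^sub>p u)"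
  have k: "k \<in> hom V \<I> \<I>"
    by (simp add: k_def hom_def)
  note [simp] = homD[OF k]
  have zk: "\<mu>w \<cdot> (\<eta>b \<otimes>\<^sub>p u) = \<eta>b \<cdot> k"
    unfolding k_def by (rule w.copyable_mult[OF z u copy_z])
  have uk: "\<mu>w \<cdot> (\<eta>b \<otimes>\<^sub>p u) = u \<cdot> k"
    unfolding k_def w_commute[OF z u] by (rule w.copyable_mult[OF u z copy_u])
  have kst: "k \<cdot> t \<cdot> s = k"
  proof -
    \<comment> \<open>\<open>x\<close> is applied to both forms \<open>\<eta>b \<cdot> k\<close> and
      \<open>u \<cdot> k\<close> of the same point; applying \<open>\<epsilon>w\<close> then yields
      an equation of scalars.\<close>
    have "\<eta>b \<cdot> k \<cdot> s = (x \<cdot> \<eta>b) \<cdot> k"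
      by (simp add: xz scalar_commute[OF k s])
    also have "\<dots> = x \<cdot> \<eta>b \<cdot> k"
      by simp
    also have "\<dots> = (x \<cdot> u) \<cdot> k"
      using zk uk by simp
    also have "\<dots> = u \<cdot> k \<cdot> t"
      by (simp add: xu scalar_commute[OF k t])
    also have "\<dots> = (u \<cdot> k) \<cdot> t"
      by simp
    also have "\<dots> = \<eta>b \<cdot> k \<cdot> t"
      using zk uk by simp
    finally have "(\<epsilon>w \<cdot> \<eta>b \<cdot> k) \<cdot> s = (\<epsilon>w \<cdot> \<eta>b \<cdot> k) \<cdot> t"
      by simp
    moreover have "\<epsilon>w \<cdot> \<eta>b \<cdot> k = k"
    proof -
      \<comment> \<open>The factor \<open>\<epsilon>w \<cdot> \<eta>b\<close> is absorbed by the
        \<open>u\<close> inside \<open>k\<close>.\<close>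
      have "k = \<epsilon>w \<cdot> \<mu>w \<cdot> ((\<eta>b \<otimes>\<^sub>p u) \<cdot> \<epsilon>w \<cdot> \<eta>b)"
        using point_tensor_scalar_right[OF z u, of "\<epsilon>w \<cdot> \<eta>b"] zez[OF u] by (simp add: k_def hom_def)
      also have "\<dots> = k \<cdot> \<epsilon>w \<cdot> \<eta>b"
        by (simp add: k_def)
      also have "\<dots> = \<epsilon>w \<cdot> \<eta>b \<cdot> k"
        using scalar_commute[OF k, of "\<epsilon>w \<cdot> \<eta>b"] by (simp add: hom_def)
      finally show ?thesis ..
    qed
    ultimately have "k \<cdot> t = k \<cdot> s"
      by simp
    then have "k \<cdot> t \<cdot> s = k \<cdot> s \<cdot> s"
      by (metis Comp_assoc k s t)
    \<comment> \<open>\<open>ss\<close> concerns points of \<open>Q\<close>, so \<open>k\<close> is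
      unfolded until \<open>s \<cdot> s\<close> meets such a point.\<close>
    also have "\<dots> = \<epsilon>w \<cdot> (\<mu>w \<cdot> (\<eta>b \<otimes>\<^sub>p u)) \<cdot> s \<cdot> s"
      by (simp add: k_def)
    also have "\<dots> = k"
      by (subst ss) (simp_all add: k_def hom_def)
    finally show ?thesis .
  qed

  \<comment> \<open>The action of the involution on the black square of \<open>u\<close>\<close>
  define N where "N = \<mu>b \<cdot> (u \<otimes>\<^sub>p u)"
  have N: "N \<in> hom V \<I> Q"
    by (simp add: N_def hom_def)
  note [simp] = homD[OF N]
  have xNs: "x \<cdot> N \<cdot> s \<in> hom V \<I> Q"
    by (simp add: hom_def)
  \<comment> \<open>The involution is moved from \<open>N\<close> onto the other argument, where it
    becomes the scalar \<open>r\<close>.\<close>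
  have cap_xNs: "\<epsilon>w \<cdot> \<mu>w \<cdot> ((x \<cdot> N \<cdot> s) \<otimes>\<^sub>p p) = \<epsilon>w \<cdot> \<mu>w \<cdot> (N \<otimes>\<^sub>p p) \<cdot> r \<cdot> s"
    if "p \<in> hom V \<I> Q" "x \<cdot> p = p \<cdot> r" "r \<in> hom V \<I> \<I>" for p r
  proof -
    note [simp] = homD[OF that(1)] homD[OF that(3)]
    have "(x \<cdot> N \<cdot> s) \<otimes>\<^sub>p p = ((x \<cdot> N) \<otimes>\<^sub>p p) \<cdot> s"
      using point_tensor_scalar_left[OF x_point[OF N] that(1) s] by simp
    then have "\<mu>w \<cdot> ((x \<cdot> N \<cdot> s) \<otimes>\<^sub>p p) = (\<mu>w \<cdot> ((x \<cdot> N) \<otimes>\<^sub>p p)) \<cdot> s"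
      by simp
    also have "\<dots> = \<mu>w \<cdot> (N \<otimes>\<^sub>p p) \<cdot> r \<cdot> s"
      using x_move[OF N that(1)] point_tensor_scalar_right[OF N that(1,3)] that(2) by simp
    finally show ?thesis
      by simp
  qed
  have N_eigen: "x \<cdot> N \<cdot> s = N"
  proof (rule w.cap_nondegenerate[OF Pb xNs N])
    fix p assume "p \<in> {\<eta>b, u}"
    then consider "p = \<eta>b" | "p = u"
      by blast
    then show "\<epsilon>w \<cdot> \<mu>w \<cdot> ((x \<cdot> N \<cdot> s) \<otimes>\<^sub>p p) = \<epsilon>w \<cdot> \<mu>w \<cdot> (N \<otimes>\<^sub>p p)"
    proof cases
      case 1
      have "\<epsilon>w \<cdot> \<mu>w \<cdot> ((x \<cdot> N \<cdot> s) \<otimes>\<^sub>p \<eta>b) = \<epsilon>w \<cdot> (\<mu>w \<cdot> (N \<otimes>\<^sub>p \<eta>b)) \<cdot> s \<cdot> s"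
        using cap_xNs[OF z xz s] by simp
      also have "\<dots> = \<epsilon>w \<cdot> \<mu>w \<cdot> (N \<otimes>\<^sub>p \<eta>b)"
        by (subst ss) (simp_all add: hom_def)
      finally show ?thesis
        using 1 by simp
    next
      case 2
      \<comment> \<open>\<open>cap_w\<close> turns the white pairing of \<open>u\<close> with
        \<open>N\<close> into \<open>\<epsilon>b \<cdot> N\<close>, a black pairing of
        \<open>u\<close> with itself, which \<open>cap_b\<close> turns into
        \<open>k\<close>.\<close>
      have Nk: "\<epsilon>w \<cdot> \<mu>w \<cdot> (N \<otimes>\<^sub>p u) = k"
        using w_commute[OF N u] cap_w[OF N] cap_b[OF u] by (simp add: N_def k_def)
      have "\<epsilon>w \<cdot> \<mu>w \<cdot> ((x \<cdot> N \<cdot> s) \<otimes>\<^sub>p u) = (\<epsilon>w \<cdot> \<mu>w \<cdot> (N \<otimes>\<^sub>p u)) \<cdot> t \<cdot> s"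
        using cap_xNs[OF u xu t] by simp
      then show ?thesis
        using Nk kst 2 by simp
    qed
  qed

  \<comment> \<open>Compatibility of the involution with addition, up to the scalar
    \<open>s\<close>\<close>
  have auto_b: "\<mu>b \<cdot> ((x \<cdot> a) \<otimes>\<^sub>p (x \<cdot> b)) = x \<cdot> \<mu>b \<cdot> (a \<otimes>\<^sub>p b) \<cdot> s"
    if a: "a \<in> hom V \<I> Q" and b: "b \<in> hom V \<I> Q" for a b
  proof -
    note [simp] = homD[OF a] homD[OF b]
    \<comment> \<open>The claim is tested after applying \<open>x\<close> to both sides, and
      \<open>x\<close> is removed again at the end by \<open>x_x\<close>.\<close>
    have f: "x \<cdot> \<mu>b \<cdot> (x \<otimes> x) \<in> hom V (Q \<otimes>\<^sub>o Q) Q"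
      by (simp add: hom_def)
    \<comment> \<open>Plugging compares arrows, so multiplication by \<open>s\<close> is realised as
      an endomorphism of \<open>Q\<close>: black addition of the scaled unit
      \<open>\<eta>b \<cdot> s\<close>.\<close>
    have g: "insert_left \<mu>b (\<eta>b \<cdot> s) \<cdot> \<mu>b \<in> hom V (Q \<otimes>\<^sub>o Q) Q"
      using insert_hom(1)[OF b.structure_hom(1), of "\<eta>b \<cdot> s"] by (auto simp: hom_def)
    have scale: "insert_left \<mu>b (\<eta>b \<cdot> s) \<cdot> c = c \<cdot> s" if "c \<in> hom V \<I> Q" for c
    proof -
      have "insert_left \<mu>b (\<eta>b \<cdot> s) \<cdot> c = \<mu>b \<cdot> ((\<eta>b \<cdot> s) \<otimes>\<^sub>p c)"
        by (rule insert_point(1)[OF b.structure_hom(1) _ that]) (simp add: hom_def)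
      also have "\<dots> = (\<mu>b \<cdot> (\<eta>b \<otimes>\<^sub>p c)) \<cdot> s"
        using homD[OF that] by (simp add: point_tensor_scalar_left[OF z that s])
      finally show ?thesis
        by (simp add: b.unit_left[OF that])
    qed
    have f_eval: "(x \<cdot> \<mu>b \<cdot> (x \<otimes> x)) \<cdot> (p \<otimes>\<^sub>p q) = x \<cdot> \<mu>b \<cdot> ((x \<cdot> p) \<otimes>\<^sub>p (x \<cdot> q))"
      and g_eval: "(insert_left \<mu>b (\<eta>b \<cdot> s) \<cdot> \<mu>b) \<cdot> (p \<otimes>\<^sub>p q) = \<mu>b \<cdot> (p \<otimes>\<^sub>p q) \<cdot> s"
      if "p \<in> hom V \<I> Q" "q \<in> hom V \<I> Q" for p q
    proof -
      note [simp] = homD[OF that(1)] homD[OF that(2)]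
      show "(x \<cdot> \<mu>b \<cdot> (x \<otimes> x)) \<cdot> (p \<otimes>\<^sub>p q) = x \<cdot> \<mu>b \<cdot> ((x \<cdot> p) \<otimes>\<^sub>p (x \<cdot> q))"
        by simp
      have i: "insert_left \<mu>b (\<eta>b \<cdot> s) \<in> hom V Q Q"
        by (rule insert_hom(1)[OF b.structure_hom(1)]) (simp add: hom_def)
      show "(insert_left \<mu>b (\<eta>b \<cdot> s) \<cdot> \<mu>b) \<cdot> (p \<otimes>\<^sub>p q) = \<mu>b \<cdot> (p \<otimes>\<^sub>p q) \<cdot> s"
        using homD[OF i] scale[of "\<mu>b \<cdot> (p \<otimes>\<^sub>p q)"] by (simp add: hom_def)
    qed
    have left_z: "x \<cdot> \<mu>b \<cdot> ((x \<cdot> \<eta>b) \<otimes>\<^sub>p (x \<cdot> q)) = \<mu>b \<cdot> (\<eta>b \<otimes>\<^sub>p q) \<cdot> s"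
      if q: "q \<in> hom V \<I> Q" for q
    proof -
      note [simp] = homD[OF q]
      have "\<mu>b \<cdot> ((x \<cdot> \<eta>b) \<otimes>\<^sub>p (x \<cdot> q)) = (\<mu>b \<cdot> (\<eta>b \<otimes>\<^sub>p (x \<cdot> q))) \<cdot> s"
        by (simp add: xz point_tensor_scalar_left[OF z x_point[OF q] s])
      then have "x \<cdot> \<mu>b \<cdot> ((x \<cdot> \<eta>b) \<otimes>\<^sub>p (x \<cdot> q)) = (x \<cdot> x \<cdot> q) \<cdot> s"
        using b.unit_left[OF x_point[OF q]] by simp
      also have "\<dots> = (\<mu>b \<cdot> (\<eta>b \<otimes>\<^sub>p q)) \<cdot> s"
        by (simp only: x_x[OF q] b.unit_left[OF q])
      finally show ?thesis
        by simp
    qed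
    have right_z: "x \<cdot> \<mu>b \<cdot> ((x \<cdot> q) \<otimes>\<^sub>p (x \<cdot> \<eta>b)) = \<mu>b \<cdot> (q \<otimes>\<^sub>p \<eta>b) \<cdot> s"
      if q: "q \<in> hom V \<I> Q" for q
    proof -
      note [simp] = homD[OF q]
      have "\<mu>b \<cdot> (q \<otimes>\<^sub>p \<eta>b) \<cdot> s = (\<mu>b \<cdot> (\<eta>b \<otimes>\<^sub>p q)) \<cdot> s"
        by (simp add: b_commute[OF z q])
      then show ?thesis
        using left_z[OF q] b_commute[OF x_point[OF q] x_point[OF z]] by simp
    qed
    have uu: "x \<cdot> \<mu>b \<cdot> ((x \<cdot> u) \<otimes>\<^sub>p (x \<cdot> u)) = \<mu>b \<cdot> (u \<otimes>\<^sub>p u) \<cdot> s"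
    proof -
      have tt: "u \<cdot> t \<cdot> t = u"
        by (rule xx_scalar[OF xu u t])
      have ut: "u \<cdot> t \<in> hom V \<I> Q"
        by (simp add: hom_def)
      \<comment> \<open>Both scalars are gathered on the first factor, where
        \<open>t \<cdot> t\<close> acts trivially on \<open>u\<close>.\<close>
      have "(x \<cdot> u) \<otimes>\<^sub>p (x \<cdot> u) = ((u \<cdot> t) \<cdot> t) \<otimes>\<^sub>p u"
        unfolding xu point_tensor_scalar_right[OF ut u t] point_tensor_scalar_left[OF ut u t] ..
      also have "\<dots> = u \<otimes>\<^sub>p u"
        using tt by simp
      finally have "x \<cdot> \<mu>b \<cdot> ((x \<cdot> u) \<otimes>\<^sub>p (x \<cdot> u)) = x \<cdot> N"
        by (simp add: N_def)
      also have "\<dots> = x \<cdot> x \<cdot> N \<cdot> s"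
        by (simp only: N_eigen)
      also have "\<dots> = N \<cdot> s"
        by (rule x_x) (simp add: hom_def)
      finally show ?thesis
        by (simp add: N_def)
    qed
    have "(x \<cdot> \<mu>b \<cdot> (x \<otimes> x)) \<cdot> (a \<otimes>\<^sub>p b) = (insert_left \<mu>b (\<eta>b \<cdot> s) \<cdot> \<mu>b) \<cdot> (a \<otimes>\<^sub>p b)"
      by (rule plugging_eq2[OF Pb f g _ a b])
        (use left_z[OF z] left_z[OF u] right_z[OF u] uu in \<open>auto simp only: f_eval g_eval z u insert_iff empty_iff\<close>)
    then have "x \<cdot> x \<cdot> \<mu>b \<cdot> ((x \<cdot> a) \<otimes>\<^sub>p (x \<cdot> b)) = x \<cdot> \<mu>b \<cdot> (a \<otimes>\<^sub>p b) \<cdot> s"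
      by (simp only: f_eval[OF a b] g_eval[OF a b])
    moreover have "x \<cdot> x \<cdot> \<mu>b \<cdot> ((x \<cdot> a) \<otimes>\<^sub>p (x \<cdot> b)) = \<mu>b \<cdot> ((x \<cdot> a) \<otimes>\<^sub>p (x \<cdot> b))"
      by (rule x_x) (simp add: hom_def)
    ultimately show ?thesis
      by simp
  qed

  \<comment> \<open>The sum of a point and its image under the involution\<close>
  define \<phi> where "\<phi> = \<mu>b \<cdot> (\<psi> \<otimes>\<^sub>p (x \<cdot> \<psi>))"
  have \<phi>: "\<phi> \<in> hom V \<I> Q"
    by (simp add: \<phi>_def hom_def)
  note [simp] = homD[OF \<phi>]
  \<comment> \<open>Commutativity swaps the summands, and \<open>x_x\<close> displays the result as
    a sum with \<open>x\<close> applied to both, ready for \<open>auto_b\<close>.\<close>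
  have "\<phi> = \<mu>b \<cdot> ((x \<cdot> \<psi>) \<otimes>\<^sub>p (x \<cdot> x \<cdot> \<psi>))"
    unfolding \<phi>_def using b_commute[OF \<psi> x_point[OF \<psi>]] x_x[OF \<psi>] by simp
  also have "\<dots> = x \<cdot> \<phi> \<cdot> s"
    using auto_b[OF \<psi> x_point[OF \<psi>]] by (simp add: \<phi>_def)
  finally have even: "x \<cdot> \<phi> \<cdot> s = \<phi>" ..
  have x_even: "x \<cdot> \<phi> = \<phi> \<cdot> s"
  proof -
    have "\<phi> \<cdot> s = (x \<cdot> \<phi> \<cdot> s) \<cdot> s"
      using even by simp
    also have "\<dots> = x \<cdot> \<phi>"
      using ss[OF \<phi>] by simp
    finally show ?thesis ..
  qed
  let ?r = "\<epsilon>w \<cdot> \<phi>"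
  have r: "?r \<in> hom V \<I> \<I>"
    by (simp add: hom_def)
  have zr: "\<eta>b \<cdot> ?r \<in> hom V \<I> Q"
    by (simp add: hom_def)
  have "\<phi> = \<eta>b \<cdot> ?r"
  \<comment> \<open>With the white plugging set the two pairings of a point \<open>a\<close> are
    \<open>\<epsilon>w \<cdot> a\<close> and \<open>\<epsilon>w \<cdot> x \<cdot> a\<close>.\<close>
  proof (rule w.cap_nondegenerate[OF assms(9) \<phi> zr])
    have re: "(\<epsilon>w \<cdot> \<eta>b) \<cdot> ?r = ?r"
      using scalar_commute[OF _ r, of "\<epsilon>w \<cdot> \<eta>b"] zez[OF \<phi>] by (simp add: hom_def)
    have *: "\<mu>w \<cdot> (a \<otimes>\<^sub>p (x \<cdot> \<eta>w)) = x \<cdot> a" if "a \<in> hom V \<I> Q" for a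
      using x_move[OF that w.structure_hom(2)] w.unit_right[OF x_point[OF that]] by simp
    fix p assume "p \<in> {\<eta>w, x \<cdot> \<eta>w}"
    then consider "p = \<eta>w" | "p = x \<cdot> \<eta>w"
      by blast
    then show "\<epsilon>w \<cdot> \<mu>w \<cdot> (\<phi> \<otimes>\<^sub>p p) = \<epsilon>w \<cdot> \<mu>w \<cdot> ((\<eta>b \<cdot> ?r) \<otimes>\<^sub>p p)"
    proof cases
      case 1
      then show ?thesis
        using re by (simp add: w.unit_right[OF \<phi>] w.unit_right[OF zr])
    next
      case 2
      \<comment> \<open>\<open>x\<close> contributes the same factor \<open>s\<close> to
        \<open>\<eta>b\<close> and to \<open>\<phi>\<close>, which reduces this case to
        \<open>re\<close>.\<close>
      have "\<epsilon>w \<cdot> x \<cdot> \<eta>b \<cdot> ?r = (\<epsilon>w \<cdot> x \<cdot> \<eta>b) \<cdot> ?r"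
        by simp
      also have "\<dots> = (\<epsilon>w \<cdot> \<eta>b) \<cdot> s \<cdot> ?r"
        by (simp add: xz)
      also have "\<dots> = ((\<epsilon>w \<cdot> \<eta>b) \<cdot> ?r) \<cdot> s"
        by (simp add: scalar_commute[OF s r])
      also have "\<dots> = \<epsilon>w \<cdot> x \<cdot> \<phi>"
        unfolding re by (simp add: x_even)
      finally show ?thesis
        using 2 by (simp add: *[OF \<phi>] *[OF zr])
    qed
  qed
  then show ?thesis
    unfolding \<phi>_def[symmetric] scalar_mult_point[OF r z] .
qed

end
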